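(* Let $0<\beta<1$, $0\le\alpha<n$, $0<\alpha+\beta<n$ and let $b$ be a locally integrable non-negative function on $\mathbb{R}^n$. Suppose that $\Phi,\Psi$ are Young functions, $\Phi\in\mathcal{Y}\cap\nabla_2$, and there are constants $C_1,C_2>0$ such that $C_1\Phi^{-1}(t)t^{-\frac{\alpha+\beta}{n}}\le\Psi^{-1}(t)\le C_2\Phi^{-1}(t)t^{-\frac{\alpha+\beta}{n}}$ for all $t>0$. Then the following statements are equivalent: 1. $b\in\dot\Lambda_\beta(\mathbb{R}^n)$. 2. $[b,M_\alpha]$ is bounded from $L^\Phi(\mathbb{R}^n)$ to $L^\Psi(\mathbb{R}^n)$. 3. There exists a constant $C>0$ such that $$\sup_B|B|^{-\beta/n}\,\Psi^{-1}\big(|B|^{-1}\big)\,\big\|b(\cdot)-|B|^{-\alpha/n}M_{\alpha,B}(b)(\cdot)\big\|_{L^\Psi(B)}\le C,$$ where the supremum is over all balls $B\subset\mathbb{R}^n$.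
   Context: A Young function is a convex, left-continuous function $\Phi:[0,\infty)\to[0,\infty]$ with $\lim_{r\to0+}\Phi(r)=\Phi(0)=0$ and $\lim_{r\to\infty}\Phi(r)=\infty$. $\mathcal{Y}$ is the set of Young functions with $0<\Phi(r)<\infty$ for all $0<r<\infty$. For a Young function, $\Phi^{-1}(s)=\inf\{r\ge0:\Phi(r)>s\}$. $\Phi\in\nabla_2$ means that there is $C>1$ with $\Phi(r)\le\frac{1}{2C}\Phi(Cr)$ for all $r\ge0$. The Orlicz space $L^\Phi(\mathbb{R}^n)$ is the set of $f\in L^1_{\rm loc}(\mathbb{R}^n)$ with $\int_{\mathbb{R}^n}\Phi(k|f(x)|)\,dx<\infty$ for some $k>0$, with norm $\|f\|_{L^\Phi}=\inf\{\lambda>0:\int_{\mathbb{R}^n}\Phi(|f(x)|/\lambda)\,dx\le1\}$; and $\|f\|_{L^\Phi(B)}=\|f\chi_B\|_{L^\Phi}$. For $0\le\alpha<n$, $M_\alpha f(x)=\sup_{B\ni x}|B|^{-1+\frac{\alpha}{n}}\int_B|f(y)|\,dy$, the supremum being over all balls $B\subset\mathbb{R}^n$ containing $x$ ($M=M_0$ is the Hardy–Littlewood maximal operator). The (nonlinear) commutator is $[b,M_\alpha](f)(x)=b(x)M_\alpha(f)(x)-M_\alpha(bf)(x)$. For a fixed ball $B_0$, $M_{\alpha,B_0}(f)(x)=\sup_{B_0\supseteq B\ni x}\frac{1}{|B|^{1-\alpha/n}}\int_B|f(y)|\,dy$, the supremum being over all balls $B$ with $B\subseteq B_0$ and $x\in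 B$. An operator $T$ is bounded from $X$ to $Y$ if there is a constant $C$ with $\|Tf\|_Y\le C\|f\|_X$ for all $f\in X$. For $0<\beta<1$, $b\in\dot\Lambda_\beta(\mathbb{R}^n)$ (Lipschitz space) means there is a constant $C$ with $|b(x)-b(y)|\le C|x-y|^\beta$ for all $x,y\in\mathbb{R}^n$ (for a locally integrable $b$, understood up to modification on a null set). *)

theory Defs
  imports "HOL-Analysis.Analysis"
begin

text \<open>
  Functions on \<open>[0,\<infinity>)\<close> are total functions on the reals whose values at negative
  arguments are never used.
\<close>

definition young :: "(real \<Rightarrow> ennreal) \<Rightarrow> bool" where
  "young \<Phi> \<longleftrightarrow>
     (\<forall>x\<ge>0. \<forall>y\<ge>0. \<forall>t\<in>{0..1}.
        \<Phi> ((1 - t) * x + t * y) \<le> ennreal (1 - t) * \<Phi> x + ennreal t * \<Phi> y) \<and>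
     (\<forall>r>0. continuous (at_left r) \<Phi>) \<and>
     \<Phi> 0 = 0 \<and> (\<Phi> \<longlongrightarrow> 0) (at_right 0) \<and> (\<Phi> \<longlongrightarrow> \<infinity>) at_top"

definition young_Y :: "(real \<Rightarrow> ennreal) set" where
  "young_Y = {\<Phi>. young \<Phi> \<and> (\<forall>r>0. 0 < \<Phi> r \<and> \<Phi> r < \<infinity>)}"

definition nabla2 :: "(real \<Rightarrow> ennreal) set" where
  "nabla2 = {\<Phi>. \<exists>C>1. \<forall>r\<ge>0. \<Phi> r \<le> ennreal (1 / (2 * C)) * \<Phi> (C * r)}"

text \<open>For a Young function the set below is nonempty, so the infimum is taken in the reals.\<close>

definition young_inv :: "(real \<Rightarrow> ennreal) \<Rightarrow> real \<Rightarrow> real" where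
  "young_inv \<Phi> s = Inf {r. r \<ge> 0 \<and> \<Phi> r > ennreal s}"

definition locally_integrable :: "('a::euclidean_space \<Rightarrow> real) \<Rightarrow> bool" where
  "locally_integrable f \<longleftrightarrow> (\<forall>K. compact K \<longrightarrow> f absolutely_integrable_on K)"

definition orlicz_space :: "(real \<Rightarrow> ennreal) \<Rightarrow> ('a::euclidean_space \<Rightarrow> real) set" where
  "orlicz_space \<Phi> =
     {f. locally_integrable f \<and> (\<exists>k>0. (\<integral>\<^sup>+x. \<Phi> (k * \<bar>f x\<bar>) \<partial>lebesgue) < \<infinity>)}"

text \<open>
  Maximal functions and commutators may take infinite values, so the norm is defined for
  extended real functions, with the convention \<open>\<Phi>(\<infinity>) = \<infinity>\<close>. It is \<open>\<infinity>\<close> if no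
  \<open>\<lambda>\<close> is admissible.
\<close>

definition young_ext :: "(real \<Rightarrow> ennreal) \<Rightarrow> ereal \<Rightarrow> ennreal" where
  "young_ext \<Phi> t = (if t = \<infinity> then \<infinity> else \<Phi> (real_of_ereal t))"

definition orlicz_norm :: "(real \<Rightarrow> ennreal) \<Rightarrow> ('a::euclidean_space \<Rightarrow> ereal) \<Rightarrow> ennreal" where
  "orlicz_norm \<Phi> g =
     (INF l\<in>{l::real. l > 0 \<and> (\<integral>\<^sup>+x. young_ext \<Phi> (\<bar>g x\<bar> / ereal l) \<partial>lebesgue) \<le> 1}. ennreal l)"

definition orlicz_norm_on ::
    "(real \<Rightarrow> ennreal) \<Rightarrow> 'a::euclidean_space set \<Rightarrow> ('a \<Rightarrow> ereal) \<Rightarrow> ennreal" where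
  "orlicz_norm_on \<Phi> B g = orlicz_norm \<Phi> (\<lambda>x. g x * indicator B x)"

definition orlicz_bounded ::
    "(real \<Rightarrow> ennreal) \<Rightarrow> (real \<Rightarrow> ennreal) \<Rightarrow>
     (('a::euclidean_space \<Rightarrow> real) \<Rightarrow> 'a \<Rightarrow> ereal) \<Rightarrow> bool" where
  "orlicz_bounded \<Phi> \<Psi> T \<longleftrightarrow>
     (\<exists>C::real. \<forall>f\<in>orlicz_space \<Phi>.
        orlicz_norm \<Psi> (T f) \<le> ennreal C * orlicz_norm \<Phi> (\<lambda>x. ereal (f x)))"

definition balls :: "'a::euclidean_space set set" where
  "balls = {ball c r | c r. r > 0}"

abbreviation vol :: "'a::euclidean_space set \<Rightarrow> real" where
  "vol B \<equiv> measure lebesgue B"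

definition frac_max :: "real \<Rightarrow> ('a::euclidean_space \<Rightarrow> real) \<Rightarrow> 'a \<Rightarrow> ennreal" where
  "frac_max \<alpha> f x =
     (SUP B\<in>{B\<in>balls. x \<in> B}.
        ennreal (vol B powr (- 1 + \<alpha> / DIM('a))) * (\<integral>\<^sup>+y\<in>B. ennreal \<bar>f y\<bar> \<partial>lebesgue))"

definition frac_max_local ::
    "real \<Rightarrow> 'a::euclidean_space set \<Rightarrow> ('a \<Rightarrow> real) \<Rightarrow> 'a \<Rightarrow> ennreal" where
  "frac_max_local \<alpha> B\<^sub>0 f x =
     (SUP B\<in>{B\<in>balls. B \<subseteq> B\<^sub>0 \<and> x \<in> B}.
        ennreal (1 / vol B powr (1 - \<alpha> / DIM('a))) * (\<integral>\<^sup>+y\<in>B. ennreal \<bar>f y\<bar> \<partial>lebesgue))"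

text \<open>
  In type \<open>ereal\<close> we have \<open>\<infinity> - \<infinity> = \<infinity>\<close> and \<open>0 * \<infinity> = 0\<close>. These conventions only
  matter where the maximal function of \<open>f\<close> is infinite; a point where only that of \<open>b f\<close> is
  infinite gives the value \<open>-\<infinity>\<close>.
\<close>

definition commutator ::
    "('a::euclidean_space \<Rightarrow> real) \<Rightarrow> real \<Rightarrow> ('a \<Rightarrow> real) \<Rightarrow> 'a \<Rightarrow> ereal" where
  "commutator b \<alpha> f x =
     ereal (b x) * enn2ereal (frac_max \<alpha> f x) - enn2ereal (frac_max \<alpha> (\<lambda>y. b y * f y) x)"

definition lipschitz_space :: "real \<Rightarrow> ('a::euclidean_space \<Rightarrow> real) set" where
  "lipschitz_space \<beta> =
     {b. \<exists>b'. (AE x in lebesgue. b x = b' x) \<and>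
         (\<exists>C. \<forall>x y. \<bar>b' x - b' y\<bar> \<le> C * norm (x - y) powr \<beta>)}"

end

theory Submission
  imports Defs
begin

text \<open>
  The three properties are compared with the Campanato condition
  \<open>\<integral>\<^sub>B |b - b\<^sub>B| \<le> C |B|\<^bsup>1 + \<beta>/n\<^esup>\<close>. Each of the two boundedness properties bounds
  the negative part of \<open>b - b\<^sub>B\<close> on \<open>B\<close>, since both maximal functions dominate
  \<open>|B|\<^bsup>\<alpha>/n\<^esup> b\<^sub>B\<close> there, and the negative part carries half of the mean oscillation.
  A Campanato function agrees almost everywhere with the limit of its ball averages, which is
  Lipschitz. Conversely, a Lipschitz \<open>b\<close> gives a pointwise bound for the local expression, and
  \<open>|[b, M\<^sub>\<alpha>] f| \<le> K M\<^bsub>\<alpha>+\<beta>\<^esub> f\<close>. Hedberg's argument reduces the boundedness of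
  \<open>M\<^bsub>\<alpha>+\<beta>\<^esub>\<close> from \<open>L\<^sup>\<Phi>\<close> to \<open>L\<^sup>\<Psi>\<close> to that of \<open>M\<close> on \<open>L\<^sup>\<Phi>\<close>, which follows from the Vitali
  covering lemma and \<open>\<Phi> \<in> \<nabla>\<^sub>2\<close>.

  The customary identity \<open>M\<^sub>\<alpha>(b \<chi>\<^sub>B) = M\<^bsub>\<alpha>,B\<^esub>(b)\<close> on \<open>B\<close> is avoided: it holds for cubes, but
  for balls in dimension at least two it fails, as the only ball inside \<open>B\<close> that contains a lens
  \<open>B \<inter> B'\<close> with \<open>B'\<close> crossing the boundary of \<open>B\<close> is \<open>B\<close> itself.
\<close>

text \<open>The two halves of the comparison between the inverse Young functions serve opposite
  directions. The lower half turns Hedberg's balance of small and large balls into a bound by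
  \<Psi>. The upper half enters when the commutator is tested on the indicator of a ball B: the norm
  of the indicator is at most the reciprocal of the inverse of \<Phi> at 1/|B|, the averaging
  estimate brings in the inverse of \<Psi> at 1/|B|, and the comparison leaves exactly the power
  |B|^(1 + \<beta>/n).

  Norms are always unfolded to an admissible \<lambda> with modular at most 1, and averages are
  controlled by a chord of the Young function. This replaces Hoelder's inequality for complementary
  functions and keeps every constant explicit.

  The commutator and the local expression enter integrals only through monotonicity, which holds for
  arbitrary functions. The function b equals a Lipschitz function b' only almost everywhere, so
  pointwise bounds are stated at points where the two agree, and b(y) is compared with b'(y) only
  under an integral.\<close>

section \<open>Young functions\<close>

text \<open>These rules would rewrite volumes of balls to \<open>lborel\<close>, away from the form \<open>vol B\<close>.\<close>

declare measure_completion [simp del] emeasure_completion [simp del]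

lemma young_scale_le:
  assumes "young \<Phi>" "0 \<le> t" "t \<le> 1" "0 \<le> r"
  shows "\<Phi> (t * r) \<le> ennreal t * \<Phi> r"
proof -
  have "\<Phi> ((1 - t) * 0 + t * r) \<le> ennreal (1 - t) * \<Phi> 0 + ennreal t * \<Phi> r"
    using assms unfolding young_def by (metis atLeastAtMost_iff order_refl)
  moreover have "\<Phi> 0 = 0" using assms by (simp add: young_def)
  ultimately show ?thesis by simp
qed

lemma young_mono:
  assumes "young \<Phi>" "0 \<le> r" "r \<le> s"
  shows "\<Phi> r \<le> \<Phi> s"
proof (cases "s = 0")
  case True
  then show ?thesis using assms by simp
next
  case False
  have "\<Phi> (r / s * s) \<le> ennreal (r / s) * \<Phi> s"
    using assms False by (intro young_scale_le) auto
  also have "\<dots> \<le> 1 * \<Phi> s"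
    using assms False by (intro mult_right_mono) auto
  finally show ?thesis using False by simp
qed

lemma young_inv_set_nonempty:
  assumes "young \<Phi>"
  shows "{r. r \<ge> 0 \<and> \<Phi> r > ennreal s} \<noteq> {}"
proof -
  have "(\<Phi> \<longlongrightarrow> \<infinity>) at_top" using assms by (simp add: young_def)
  then have "eventually (\<lambda>r. \<Phi> r > ennreal s) at_top"
    by (rule order_tendstoD) simp
  then have "eventually (\<lambda>r. \<Phi> r > ennreal s \<and> r \<ge> 0) at_top"
    using eventually_ge_at_top[of 0] by eventually_elim auto
  then show ?thesis using eventually_happens' by force
qed

lemma le_young_inv:
  assumes "young \<Phi>" "0 \<le> r" "\<Phi> r \<le> ennreal s"
  shows "r \<le> young_inv \<Phi> s"
  unfolding young_inv_def
proof (rule cInf_greatest[OF young_inv_set_nonempty[OF assms(1)]])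
  fix x assume "x \<in> {r. r \<ge> 0 \<and> \<Phi> r > ennreal s}"
  then show "r \<le> x"
    using young_mono[OF assms(1), of x r] assms(3) by (fastforce simp: not_le[symmetric])
qed

lemma young_inv_le:
  assumes "0 \<le> r" "ennreal s < \<Phi> r"
  shows "young_inv \<Phi> s \<le> r"
  unfolding young_inv_def by (rule cInf_lower) (use assms in \<open>auto intro: bdd_belowI[of _ 0]\<close>)

lemma young_inv_pos:
  assumes "young \<Phi>" "0 < s"
  shows "0 < young_inv \<Phi> s"
proof -
  have "(\<Phi> \<longlongrightarrow> 0) (at_right 0)" using assms by (simp add: young_def)
  then have "eventually (\<lambda>r. \<Phi> r < ennreal s) (at_right 0)"
    by (rule order_tendstoD) (use assms in simp)
  then have "eventually (\<lambda>r. \<Phi> r < ennreal s \<and> r > 0) (at_right 0)"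
    using eventually_at_right_less[of 0] by eventually_elim auto
  then obtain r where "\<Phi> r < ennreal s" "r > 0"
    using eventually_happens'[OF trivial_limit_at_right_real] by blast
  then show ?thesis using le_young_inv[OF assms(1), of r s] by (simp add: less_imp_le)
qed

lemma young_inv_mono:
  assumes "young \<Phi>" "s \<le> t"
  shows "young_inv \<Phi> s \<le> young_inv \<Phi> t"
  unfolding young_inv_def
  by (rule cInf_superset_mono[OF young_inv_set_nonempty[OF assms(1)]])
    (use assms(2) in \<open>auto intro: bdd_belowI[of _ 0] ennreal_leI le_less_trans\<close>)

text \<open>Left of the infimum no value exceeds \<open>s\<close>. Left continuity carries this to
  the infimum itself, even if \<Phi> jumps to \<infinity> just after it.\<close>

lemma young_young_inv_le:
  assumes "young \<Phi>" "0 < s"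
  shows "\<Phi> (young_inv \<Phi> s) \<le> ennreal s"
proof -
  let ?u = "young_inv \<Phi> s"
  have u: "0 < ?u" by (rule young_inv_pos[OF assms])
  then have "(\<Phi> \<longlongrightarrow> \<Phi> ?u) (at_left ?u)"
    using assms(1) by (simp add: young_def continuous_within)
  moreover have "eventually (\<lambda>r. \<Phi> r \<le> ennreal s) (at_left ?u)"
    using eventually_at_left_real[OF u]
  proof eventually_elim
    case (elim r)
    then show ?case using young_inv_le[of r s \<Phi>] by (auto simp: not_le[symmetric])
  qed
  ultimately show ?thesis
    by (rule tendsto_upperbound) simp
qed

text \<open>A linear lower bound for a Young function that takes the place of Jensen's inequality:
  beyond \<open>\<Phi>\<^sup>-\<^sup>1(s)\<close> the graph lies above the chord from the origin.\<close>

lemma young_linear_bound: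
  assumes "young \<Phi>" "0 < s" "0 \<le> r"
  shows "ennreal (r * s) \<le> ennreal (young_inv \<Phi> s) * (ennreal s + \<Phi> r)"
proof (cases "\<Phi> r")
  case top
  then show ?thesis using young_inv_pos[OF assms(1,2)] by (simp add: ennreal_mult_top)
next
  case (real p)
  let ?u = "young_inv \<Phi> s"
  have u: "0 < ?u" by (rule young_inv_pos[OF assms(1,2)])
  have "r * s \<le> ?u * (s + p)"
  proof (cases "r \<le> ?u")
    case True
    then have "r * s \<le> ?u * s" using assms by simp
    also have "\<dots> \<le> ?u * (s + p)" using u real by simp
    finally show ?thesis .
  next
    case False
    \<comment> \<open>At \<open>?u\<close> the value of \<Phi> can lie below \<open>s\<close>, when
      \<Phi> is infinite beyond it. The chord argument is therefore run at \<open>v > ?u\<close>,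
      where \<Phi> exceeds \<open>s\<close>, and \<open>v\<close> tends to \<open>?u\<close>
      afterwards.\<close>
    have "s * r \<le> v * p" if v: "?u < v" "v < r" for v
    proof -
      have "ennreal s < \<Phi> v"
        using le_young_inv[OF assms(1), of v s] v u by (auto simp: not_le[symmetric])
      also have "\<Phi> v \<le> ennreal (v / r) * \<Phi> r"
        using young_scale_le[OF assms(1), of "v / r" r] v u by auto
      also have "\<dots> = ennreal (v / r * p)"
        using v u real by (subst ennreal_mult) auto
      finally have "s < v / r * p" using assms(2) by (simp add: ennreal_less_iff)
      then show ?thesis using v u by (simp add: field_simps)
    qed
    then have ev: "eventually (\<lambda>v. s * r \<le> v * p) (at_right ?u)"
      using False by (intro eventually_at_right_real[THEN eventually_mono]) auto
    have "((\<lambda>v. v * p) \<longlongrightarrow> ?u * p) (at_right ?u)" by (intro tendsto_intros)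
    from tendsto_lowerbound[OF this ev] have "s * r \<le> ?u * p" by simp
    also have "\<dots> \<le> ?u * (s + p)" using u assms(2) by simp
    finally show ?thesis by (simp add: mult.commute)
  qed
  then show ?thesis
    using real u assms(2) by (simp add: ennreal_mult[symmetric] ennreal_plus[symmetric] del: ennreal_plus)
qed

lemma borel_measurable_young:
  assumes "young \<Phi>" "g \<in> borel_measurable M" "\<And>x. 0 \<le> g x"
  shows "(\<lambda>x. \<Phi> (g x)) \<in> borel_measurable M"
proof -
  \<comment> \<open>Values at negative arguments are unconstrained; the truncation makes \<Phi>
    monotone on the whole line, so that superlevel sets are intervals.\<close>
  have "mono (\<lambda>r. \<Phi> (max 0 r))"
    by (intro monoI young_mono[OF assms(1)]) auto
  then have "(\<lambda>r. \<Phi> (max 0 r)) \<in> borel_measurable borel"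
  proof (intro borel_measurableI_greater)
    fix y
    have "is_interval {r. y < \<Phi> (max 0 r)}"
      unfolding is_interval_1 using monoD[OF \<open>mono _\<close>] by (auto intro: less_le_trans)
    then show "{r \<in> space borel. y < \<Phi> (max 0 r)} \<in> sets borel"
      by (simp add: real_interval_borel_measurable)
  qed
  from measurable_compose[OF assms(2) this] show ?thesis
    using assms(3) by (simp add: max_absorb2)
qed

text \<open>Integrate \<open>young_linear_bound\<close> with \<open>s = 1 / v\<close> over
  \<open>B\<close>. The constant term and the modular term each contribute at most
  \<open>v * young_inv \<Phi> (1 / v)\<close>, hence the factor 2.\<close>

lemma nn_integral_young_average:
  fixes h :: "'a::euclidean_space \<Rightarrow> real"
  assumes "young \<Phi>" "h \<in> borel_measurable lebesgue" "\<And>x. 0 \<le> h x"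
    and "(\<integral>\<^sup>+x. \<Phi> (h x) \<partial>lebesgue) \<le> 1"
    and B: "B \<in> sets lebesgue" "emeasure lebesgue B = ennreal v" "0 < v"
  shows "(\<integral>\<^sup>+x\<in>B. ennreal (h x) \<partial>lebesgue) \<le> ennreal (2 * v * young_inv \<Phi> (1 / v))"
proof -
  let ?u = "young_inv \<Phi> (1 / v)"
  note [measurable] = assms(2) B(1) borel_measurable_young[OF assms(1-3)]
  have u: "0 < ?u" using B by (intro young_inv_pos[OF assms(1)]) simp
  have *: "ennreal (h x) \<le> ennreal ?u * (1 + ennreal v * \<Phi> (h x))" for x
  proof -
    have "ennreal (h x) = ennreal v * ennreal (h x * (1 / v))"
      using B assms(3)[of x] by (simp add: ennreal_mult[symmetric])
    also have "\<dots> \<le> ennreal v * (ennreal ?u * (ennreal (1 / v) + \<Phi> (h x)))"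
      using B by (intro mult_left_mono young_linear_bound assms) auto
    also have "\<dots> = ennreal ?u * (ennreal v * ennreal (1 / v) + ennreal v * \<Phi> (h x))"
      by (simp add: algebra_simps)
    also have "ennreal v * ennreal (1 / v) = 1"
      using B by (simp add: ennreal_mult[symmetric])
    finally show ?thesis .
  qed
  have "(\<integral>\<^sup>+x\<in>B. ennreal (h x) \<partial>lebesgue) \<le>
        (\<integral>\<^sup>+x. ennreal ?u * (indicator B x + ennreal v * \<Phi> (h x)) \<partial>lebesgue)"
    by (intro nn_integral_mono) (use * in \<open>auto split: split_indicator\<close>)
  also have "\<dots> = ennreal ?u * (ennreal v + ennreal v * (\<integral>\<^sup>+x. \<Phi> (h x) \<partial>lebesgue))"
    using B by (simp add: nn_integral_cmult nn_integral_add)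
  also have "\<dots> \<le> ennreal ?u * (ennreal v + ennreal v * 1)"
    by (intro mult_left_mono add_left_mono assms) auto
  also have "\<dots> = ennreal (2 * v * ?u)"
    using u B by (simp add: ennreal_mult[symmetric] ennreal_plus[symmetric] algebra_simps del: ennreal_plus)
  finally show ?thesis .
qed

section \<open>Balls and coverings\<close>

text \<open>Subadditivity in the form that matches \<open>emeasure_UN_countable\<close>, with a sum
  over an arbitrary countable index set. The indicator of a union is at most the sum of the
  indicators, and Tonelli exchanges sum and integral.\<close>

lemma emeasure_UN_countable_le:
  assumes [measurable]: "\<And>i. i \<in> I \<Longrightarrow> X i \<in> sets M" and "countable I"
  shows "emeasure M (\<Union>i\<in>I. X i) \<le> (\<integral>\<^sup>+i. emeasure M (X i) \<partial>count_space I)"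
proof -
  have [measurable]: "(\<Union>i\<in>I. X i) \<in> sets M"
    using assms by (intro sets.countable_UN'') auto
  have le: "indicator (\<Union>i\<in>I. X i) x \<le> (\<integral>\<^sup>+i. indicator (X i) x \<partial>count_space I)" for x
  proof (cases "x \<in> (\<Union>i\<in>I. X i)")
    case True
    then obtain j where j: "j \<in> I" "x \<in> X j" by auto
    then have "(1::ennreal) = (\<integral>\<^sup>+i. indicator {j} i \<partial>count_space I)"
      by (simp add: one_ennreal_def[symmetric])
    also have "\<dots> \<le> (\<integral>\<^sup>+i. indicator (X i) x \<partial>count_space I)"
      by (intro nn_integral_mono) (use j in \<open>auto split: split_indicator\<close>)
    finally show ?thesis using True by simp
  qed simp
  have "emeasure M (\<Union>i\<in>I. X i) = (\<integral>\<^sup>+x. indicator (\<Union>i\<in>I. X i) x \<partial>M)" by simp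
  also have "\<dots> \<le> (\<integral>\<^sup>+x. \<integral>\<^sup>+i. indicator (X i) x \<partial>count_space I \<partial>M)"
    by (intro nn_integral_mono le)
  also have "\<dots> = (\<integral>\<^sup>+i. \<integral>\<^sup>+x. indicator (X i) x \<partial>M \<partial>count_space I)"
    using assms by (intro nn_integral_count_space_nn_integral) auto
  also have "\<dots> = (\<integral>\<^sup>+i. emeasure M (X i) \<partial>count_space I)"
    using assms by (intro nn_integral_cong) simp
  finally show ?thesis .
qed


text \<open>Vitali selects disjoint balls whose fivefold enlargements cover \<open>S\<close>; the
  hypothesis compares each enlargement with its ball, and the disjoint balls add up inside
  \<open>T\<close>. Two measures are kept apart because the roles get exchanged: \<mu> is Lebesgue
  measure in the weak type estimate, and \<nu> is Lebesgue measure when a Campanato function is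
  identified almost everywhere.\<close>

lemma vitali_measure_bound:
  fixes c :: "'i \<Rightarrow> 'a::euclidean_space"
  assumes sets: "sets \<mu> = sets lebesgue" "sets \<nu> = sets lebesgue"
    and r: "\<And>i. i \<in> I \<Longrightarrow> 0 < r i \<and> r i \<le> R"
    and le: "\<And>i. i \<in> I \<Longrightarrow> emeasure \<mu> (ball (c i) (5 * r i)) \<le> k * emeasure \<nu> (ball (c i) (r i))"
    and S: "S \<subseteq> (\<Union>i\<in>I. ball (c i) (r i))"
    and T: "(\<Union>i\<in>I. ball (c i) (r i)) \<subseteq> T" "T \<in> sets lebesgue"
  shows "emeasure \<mu> S \<le> k * emeasure \<nu> T"
proof -
  obtain J where J: "countable J" "J \<subseteq> I"
    and disj: "pairwise (\<lambda>i j. disjnt (ball (c i) (r i)) (ball (c j) (r j))) J"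
    and cov: "S \<subseteq> (\<Union>i\<in>J. ball (c i) (5 * r i))"
    using Vitali_covering_lemma_balls[OF S, of R] r by blast
  have bs[measurable]: "ball x e \<in> sets \<mu>" "ball x e \<in> sets \<nu>" for x e
    by (simp_all add: sets)
  have "emeasure \<mu> S \<le> emeasure \<mu> (\<Union>i\<in>J. ball (c i) (5 * r i))"
    by (rule emeasure_mono[OF cov]) (use J in \<open>auto intro!: sets.countable_UN''\<close>)
  also have "\<dots> \<le> (\<integral>\<^sup>+i. emeasure \<mu> (ball (c i) (5 * r i)) \<partial>count_space J)"
    by (rule emeasure_UN_countable_le) (use J in auto)
  also have "\<dots> \<le> (\<integral>\<^sup>+i. k * emeasure \<nu> (ball (c i) (r i)) \<partial>count_space J)"
    by (intro nn_integral_mono) (use le J in auto)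
  also have "\<dots> = k * (\<integral>\<^sup>+i. emeasure \<nu> (ball (c i) (r i)) \<partial>count_space J)"
    by (rule nn_integral_cmult) simp
  also have "(\<integral>\<^sup>+i. emeasure \<nu> (ball (c i) (r i)) \<partial>count_space J) =
             emeasure \<nu> (\<Union>i\<in>J. ball (c i) (r i))"
    by (rule emeasure_UN_countable[symmetric])
      (use J disj in \<open>auto simp: disjoint_family_on_def pairwise_def disjnt_def\<close>)
  also have "\<dots> \<le> emeasure \<nu> T"
    by (rule emeasure_mono) (use J T sets in auto)
  finally show ?thesis by (simp add: mult_left_mono)
qed

section \<open>Volumes of balls and local integrability\<close>

lemma emeasure_lebesgue_ball:
  fixes c :: "'a::euclidean_space"
  assumes "0 \<le> r"
  shows "emeasure lebesgue (ball c r) = ennreal (unit_ball_vol DIM('a) * r ^ DIM('a))"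
  using emeasure_ball[OF assms, of c] by (simp add: emeasure_completion)

lemma vol_ball:
  fixes c :: "'a::euclidean_space"
  assumes "0 \<le> r"
  shows "vol (ball c r) = unit_ball_vol DIM('a) * r ^ DIM('a)"
  using content_ball[OF assms, of c] by (simp add: measure_completion)

lemma vol_ball_pos: "0 < r \<Longrightarrow> 0 < vol (ball (c :: 'a::euclidean_space) r)"
  by (simp add: vol_ball)

lemma vol_ball_mult:
  "0 \<le> r \<Longrightarrow> 0 \<le> k \<Longrightarrow> vol (ball (x :: 'a::euclidean_space) (k * r)) = k ^ DIM('a) * vol (ball (y :: 'a) r)"
  by (simp add: vol_ball power_mult_distrib)

lemma emeasure_ball_eq_vol:
  "emeasure lebesgue (ball (c :: 'a::euclidean_space) r) = ennreal (vol (ball c r))"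
  using emeasure_lborel_ball_finite[of c r]
  by (intro emeasure_eq_ennreal_measure) (simp add: emeasure_completion less_top)

lemma vol_ball_powr:
  fixes c :: "'a::euclidean_space"
  assumes "0 < r"
  shows "vol (ball c r) powr (\<beta> / DIM('a)) = unit_ball_vol DIM('a) powr (\<beta> / DIM('a)) * r powr \<beta>"
proof -
  have "r ^ DIM('a) = r powr DIM('a)" using assms by (simp add: powr_realpow)
  then have "vol (ball c r) = unit_ball_vol DIM('a) * r powr DIM('a)"
    using assms by (simp add: vol_ball)
  then show ?thesis using assms by (simp add: powr_mult powr_powr)
qed

lemma balls_imp_vol_pos:
  assumes "B \<in> balls"
  shows "0 < vol B" "B \<in> sets lebesgue" "emeasure lebesgue B = ennreal (vol B)" "open B"
  using assms by (auto simp: balls_def vol_ball_pos emeasure_ball_eq_vol)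

lemma locally_integrable_measurable:
  fixes f :: "'a::euclidean_space \<Rightarrow> real"
  assumes "locally_integrable f"
  shows "f \<in> borel_measurable lebesgue"
proof (rule borel_measurable_LIMSEQ_real)
  fix x :: 'a
  have "eventually (\<lambda>k. indicator (cball 0 (real k)) x * f x = f x) sequentially"
    using eventually_ge_at_top[of "nat \<lceil>norm x\<rceil>"]
    by eventually_elim (auto simp: indicator_def)
  then show "(\<lambda>k. indicator (cball 0 (real k)) x * f x) \<longlonglongrightarrow> f x"
    by (rule tendsto_eventually)
next
  fix k :: nat
  have "f absolutely_integrable_on cball 0 (real k)"
    using assms by (auto simp: locally_integrable_def)
  then show "(\<lambda>x. indicator (cball 0 (real k)) x * f x) \<in> borel_measurable lebesgue"
    by (auto simp: set_integrable_def)
qed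

lemma locally_integrable_ball:
  assumes "locally_integrable f"
  shows "set_integrable lebesgue (ball c r) f"
proof (rule set_integrable_subset)
  show "set_integrable lebesgue (cball c r) f"
    using assms compact_cball[of c r] unfolding locally_integrable_def by blast
qed (auto intro: ball_subset_cball)

section \<open>The maximal operator on Orlicz spaces\<close>

text \<open>The supremum runs over all open balls through the point, not only centred ones, so a
  superlevel set is the union of the balls that witness it. This is the source of measurability for
  maximal functions.\<close>

lemma open_frac_max_superlevel: "open {x. t < frac_max \<alpha> f x}"
proof -
  have "{x. t < frac_max \<alpha> f x} = \<Union>{B \<in> balls. t <
      ennreal (vol B powr (- 1 + \<alpha> / DIM('a))) * (\<integral>\<^sup>+y\<in>B. ennreal \<bar>f y\<bar> \<partial>lebesgue)}"
    by (auto simp: frac_max_def less_SUP_iff)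
  then show ?thesis by (auto intro: balls_imp_vol_pos(4))
qed

text \<open>The weak (1,1) bound, truncated. The part of \<open>F\<close> below \<open>t\<close>
  adds at most \<open>t\<close> to an average, so an average above \<open>2 * t\<close> forces the
  part above \<open>t\<close> to have average at least \<open>t\<close>. The factor 5^n is the
  Vitali enlargement; the truncation is what lets the levels be summed later.\<close>

lemma maximal_weak_type:
  fixes F :: "'a::euclidean_space \<Rightarrow> real"
  assumes [measurable]: "F \<in> borel_measurable lebesgue" and F: "\<And>x. 0 \<le> F x" and t: "0 < t"
  shows "emeasure lebesgue {x. ennreal (2 * t) < frac_max 0 F x} \<le>
    ennreal (5 ^ DIM('a) / t) * (\<integral>\<^sup>+x. ennreal (F x) * indicator {y. t < F y} x \<partial>lebesgue)"
proof -
  let ?g = "\<lambda>x. ennreal (F x) * indicator {y. t < F y} x"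
  have "{y \<in> space lebesgue. t < F y} \<in> sets lebesgue" by measurable
  then have [measurable]: "{y. t < F y} \<in> sets lebesgue" by simp
  have g: "?g \<in> borel_measurable lebesgue" by measurable
  define \<nu> where "\<nu> = density lebesgue ?g"
  have \<nu>: "emeasure \<nu> A = (\<integral>\<^sup>+x\<in>A. ?g x \<partial>lebesgue)" if "A \<in> sets lebesgue" for A
    unfolding \<nu>_def by (rule emeasure_density[OF g that])
  define I where "I = {(c::'a, r). 0 < r \<and> ennreal t * emeasure lebesgue (ball c r) \<le> emeasure \<nu> (ball c r)}"
  show ?thesis
  proof (cases "\<integral>\<^sup>+x. ?g x \<partial>lebesgue")
    case top
    then show ?thesis using t by (simp add: ennreal_mult_top)
  next
    case (real G)
    have UNIV: "emeasure \<nu> UNIV = ennreal G"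
      using real by (subst \<nu>) simp_all
    have "emeasure lebesgue {x. ennreal (2 * t) < frac_max 0 F x} \<le> ennreal (5 ^ DIM('a) / t) * emeasure \<nu> UNIV"
    proof (rule vitali_measure_bound[where I = I and c = fst and r = snd
          and R = "max 1 (G / (t * unit_ball_vol DIM('a)))"])
      show "sets lebesgue = sets lebesgue" "sets \<nu> = sets lebesgue" by (simp_all add: \<nu>_def)
      fix i assume "i \<in> I"
      then obtain c r where i: "i = (c, r)" "0 < r"
        and le: "ennreal t * emeasure lebesgue (ball c r) \<le> emeasure \<nu> (ball c r)"
        by (auto simp: I_def)
      have "ennreal (t * (unit_ball_vol DIM('a) * r ^ DIM('a))) \<le> emeasure \<nu> (ball c r)"
        using le i t by (simp add: emeasure_lebesgue_ball ennreal_mult[symmetric])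
      also have "\<dots> \<le> emeasure \<nu> UNIV" by (rule emeasure_mono) (auto simp: \<nu>_def)
      finally have *: "t * (unit_ball_vol DIM('a) * r ^ DIM('a)) \<le> G"
        using UNIV real by simp
      \<comment> \<open>The covering lemma needs bounded radii. Finite total mass \<open>G\<close>
        bounds \<open>r ^ DIM('a)\<close>, which dominates \<open>r\<close> once
        \<open>r > 1\<close>; smaller radii are covered by the 1 in the maximum.\<close>
      have "r \<le> G / (t * unit_ball_vol DIM('a))" if "1 < r"
      proof -
        have "r \<le> r ^ DIM('a)" using that by (intro self_le_power) auto
        also have "\<dots> \<le> G / (t * unit_ball_vol DIM('a))"
          using * t by (simp add: field_simps)
        finally show ?thesis .
      qed
      then show "0 < snd i \<and> snd i \<le> max 1 (G / (t * unit_ball_vol DIM('a)))"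
        using i by (cases "1 < r") (simp_all add: le_max_iff_disj)
      have "emeasure lebesgue (ball c (5 * r)) = ennreal (5 ^ DIM('a) / t) * (ennreal t * emeasure lebesgue (ball c r))"
        using i t by (simp add: emeasure_lebesgue_ball ennreal_mult[symmetric] power_mult_distrib field_simps)
      also have "\<dots> \<le> ennreal (5 ^ DIM('a) / t) * emeasure \<nu> (ball c r)"
        by (intro mult_left_mono le) auto
      finally show "emeasure lebesgue (ball (fst i) (5 * snd i)) \<le> ennreal (5 ^ DIM('a) / t) * emeasure \<nu> (ball (fst i) (snd i))"
        using i by simp
    next
      show "{x. ennreal (2 * t) < frac_max 0 F x} \<subseteq> (\<Union>i\<in>I. ball (fst i) (snd i))"
      proof
        fix x assume "x \<in> {x. ennreal (2 * t) < frac_max 0 F x}"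
        then obtain c r where cr: "0 < r" "x \<in> ball c r"
          and *: "ennreal (2 * t) < ennreal (vol (ball c r) powr - 1) * (\<integral>\<^sup>+y\<in>ball c r. ennreal (F y) \<partial>lebesgue)"
          using F by (auto simp: frac_max_def less_SUP_iff balls_def)
        define v where "v = vol (ball c r)"
        have v: "0 < v" "emeasure lebesgue (ball c r) = ennreal v"
          using cr by (simp_all add: v_def vol_ball_pos emeasure_ball_eq_vol)
        have [measurable]: "ball c r \<in> sets lebesgue" by simp
        have "(\<integral>\<^sup>+y\<in>ball c r. ennreal (F y) \<partial>lebesgue) \<le>
              (\<integral>\<^sup>+y. ennreal t * indicator (ball c r) y + ?g y * indicator (ball c r) y \<partial>lebesgue)"
          by (intro nn_integral_mono) (auto split: split_indicator intro: ennreal_leI)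
        also have "\<dots> = ennreal t * ennreal v + emeasure \<nu> (ball c r)"
          using v by (subst nn_integral_add) (auto simp: nn_integral_cmult_indicator \<nu>)
        finally have le: "(\<integral>\<^sup>+y\<in>ball c r. ennreal (F y) \<partial>lebesgue) \<le> ennreal t * ennreal v + emeasure \<nu> (ball c r)" .
        have "ennreal t * ennreal v \<le> emeasure \<nu> (ball c r)"
        proof (rule ccontr)
          assume "\<not> ennreal t * ennreal v \<le> emeasure \<nu> (ball c r)"
          then have "emeasure \<nu> (ball c r) \<le> ennreal t * ennreal v" by simp
          then have "(\<integral>\<^sup>+y\<in>ball c r. ennreal (F y) \<partial>lebesgue) \<le> ennreal t * ennreal v + ennreal t * ennreal v"
            using le by (meson add_left_mono order_trans)
          then have "ennreal (v powr - 1) * (\<integral>\<^sup>+y\<in>ball c r. ennreal (F y) \<partial>lebesgue) \<le>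
              ennreal (v powr - 1) * (ennreal t * ennreal v + ennreal t * ennreal v)"
            by (intro mult_left_mono) auto
          also have "\<dots> = ennreal (2 * t)"
            using v t by (simp add: ennreal_mult[symmetric] ennreal_plus[symmetric] powr_minus field_simps del: ennreal_plus)
          finally show False using * by (simp add: v_def not_le[symmetric])
        qed
        then have "(c, r) \<in> I" using cr v by (simp add: I_def)
        then show "x \<in> (\<Union>i\<in>I. ball (fst i) (snd i))" using cr by force
      qed
    qed auto
    then show ?thesis using UNIV real by simp
  qed
qed

section \<open>Summation over levels and the strong type estimate\<close>

lemma nabla2_iterate:
  assumes "1 < a" "\<And>r. 0 \<le> r \<Longrightarrow> \<Phi> r \<le> ennreal (1 / (2 * a)) * \<Phi> (a * r)" "0 \<le> r"
  shows "\<Phi> r \<le> ennreal ((1 / (2 * a)) ^ j) * \<Phi> (a ^ j * r)"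
proof (induction j)
  case (Suc j)
  have "\<Phi> (a ^ j * r) \<le> ennreal (1 / (2 * a)) * \<Phi> (a * (a ^ j * r))"
    using assms by (intro assms(2)) simp
  then have "\<Phi> r \<le> ennreal ((1 / (2 * a)) ^ j) * (ennreal (1 / (2 * a)) * \<Phi> (a * (a ^ j * r)))"
    using Suc by (meson mult_left_mono order_trans zero_le)
  also have "\<dots> = (ennreal ((1 / (2 * a)) ^ j) * ennreal (1 / (2 * a))) * \<Phi> (a ^ Suc j * r)"
    by (simp add: mult.assoc)
  also have "ennreal ((1 / (2 * a)) ^ j) * ennreal (1 / (2 * a)) = ennreal ((1 / (2 * a)) ^ Suc j)"
    using assms(1) by (subst ennreal_mult[symmetric]) (auto simp: mult.commute)
  finally show ?case .
qed simp

text \<open>Levels are indexed by all integers, while \<open>suminf\<close> runs over the naturals,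
  so \<open>int_decode\<close> enumerates the levels. Passing through the counting measure reorders
  the terms into a geometric series descending from \<open>K\<close>.\<close>

lemma suminf_int_decode_geometric:
  fixes K :: int
  assumes "0 \<le> d"
  shows "(\<Sum>i. (if int_decode i \<le> K then ennreal (d * (1 / 2) ^ nat (K - int_decode i)) else 0)) = ennreal (2 * d)"
proof -
  let ?v = "\<lambda>k. if k \<le> K then ennreal (d * (1 / 2) ^ nat (K - k)) else 0"
  have "(\<Sum>i. ?v (int_decode i)) = (\<integral>\<^sup>+i. ?v (int_decode i) \<partial>count_space UNIV)"
    by (rule nn_integral_count_space_nat[symmetric])
  also have "\<dots> = (\<integral>\<^sup>+k. ?v k \<partial>count_space UNIV)"
    by (rule nn_integral_bij_count_space) (rule bij_int_decode)
  also have "\<dots> = (\<integral>\<^sup>+k. ?v k * indicator {..K} k \<partial>count_space UNIV)"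
    by (intro nn_integral_cong) auto
  also have "\<dots> = (\<integral>\<^sup>+k. ?v k \<partial>count_space {..K})"
    by (rule nn_integral_count_space_indicator[symmetric]) simp
  also have "\<dots> = (\<integral>\<^sup>+j. ?v (K - int j) \<partial>count_space UNIV)"
    by (rule nn_integral_bij_count_space[symmetric], rule bij_betw_byWitness[where f' = "\<lambda>k. nat (K - k)"]) auto
  also have "\<dots> = (\<Sum>j. ennreal (d * (1 / 2) ^ j))"
    by (simp add: nn_integral_count_space_nat)
  also have "\<dots> = ennreal (\<Sum>j. d * (1 / 2) ^ j)"
    using assms by (intro suminf_ennreal2) (auto intro!: summable_mult summable_geometric)
  also have "(\<Sum>j. d * (1 / 2 :: real) ^ j) = 2 * d"
    by (subst suminf_mult) (auto simp: suminf_geometric)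
  finally show ?thesis .
qed

lemma powr_bracket:
  fixes a u :: real
  assumes "1 < a" "0 < u"
  obtains k :: int where "a powr k < u" "u \<le> a powr (real_of_int k + 1)"
    "\<And>j. a powr real_of_int j < u \<longleftrightarrow> j \<le> k"
proof -
  \<comment> \<open>The lower inequality is strict, so \<open>k\<close> is the ceiling of the
    logarithm minus one rather than its floor.\<close>
  have *: "a powr real_of_int j < u \<longleftrightarrow> j \<le> \<lceil>log a u\<rceil> - 1" for j :: int
    using assms less_log_iff[of a u "real_of_int j"] by (simp add: less_ceiling_iff)
  show thesis
    using *[of "\<lceil>log a u\<rceil> - 1"] *[of "\<lceil>log a u\<rceil>"] by (intro that[OF _ _ *]) auto
qed

text \<open>Only levels \<open>k \<le> K\<close> contribute, where
  \<open>a powr K < y \<le> a powr (K + 1)\<close>. At \<open>j\<close> levels below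
  \<open>K\<close>, the condition \<open>nabla2\<close> shrinks the value of \<Phi> by
  \<open>(2 * a) ^ j\<close>, while the weight \<open>y / a powr k\<close> grows by at most
  \<open>a ^ j\<close> up to one factor \<open>a\<close>. What remains is
  \<open>a * (1 / 2) ^ j\<close>, with sum \<open>2 * a\<close>.\<close>

lemma nabla2_layer_sum:
  assumes "young \<Phi>" "1 < a" "\<And>r. 0 \<le> r \<Longrightarrow> \<Phi> r \<le> ennreal (1 / (2 * a)) * \<Phi> (a * r)" "0 \<le> y"
  shows "(\<Sum>i. \<Phi> (a powr (int_decode i + 1)) *
      (ennreal (1 / a powr int_decode i) * (ennreal y * indicator {z. a powr int_decode i < z} y)))
    \<le> ennreal (2 * a) * \<Phi> (a * y)"
proof (cases "y = 0")
  case False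
  then have y: "0 < y" using assms by simp
  obtain K where K: "a powr real_of_int K < y" "y \<le> a powr (real_of_int K + 1)"
    "\<And>j. a powr real_of_int j < y \<longleftrightarrow> j \<le> K"
    using powr_bracket[OF assms(2) y] by blast
  have a: "0 < a" using assms by simp
  have bound: "\<Phi> (a powr (k + 1)) * (ennreal (1 / a powr k) * (ennreal y * indicator {z. a powr k < z} y))
     \<le> (if k \<le> K then ennreal (a * (1 / 2) ^ nat (K - k)) else 0) * \<Phi> (a * y)" (is "?l \<le> ?r") for k :: int
  proof (cases "k \<le> K")
    case True
    define j where "j = nat (K - k)"
    have k: "real_of_int k = K - real j" using True by (simp add: j_def)
    have aK: "a ^ j * a powr (k + 1) = a powr (K + 1)"
      using a by (simp add: powr_realpow[symmetric] powr_add[symmetric] k)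
    have "\<Phi> (a powr (k + 1)) \<le> ennreal ((1 / (2 * a)) ^ j) * \<Phi> (a powr (K + 1))"
      using nabla2_iterate[of a \<Phi> "a powr (k + 1)" j] assms(2,3) aK by simp
    also have "\<dots> \<le> ennreal ((1 / (2 * a)) ^ j) * \<Phi> (a * y)"
      using K(1) a by (intro mult_left_mono young_mono[OF assms(1)]) (auto simp: powr_add)
    finally have 1: "\<Phi> (a powr (k + 1)) \<le> ennreal ((1 / (2 * a)) ^ j) * \<Phi> (a * y)" .
    have "1 / a powr k * y \<le> 1 / a powr k * a powr (K + 1)"
      using K by (intro mult_left_mono) auto
    also have "\<dots> = a ^ j * a"
      using a by (simp add: powr_realpow[symmetric] k powr_add powr_diff field_simps)
    finally have 2: "(1 / (2 * a)) ^ j * (1 / a powr k * y) \<le> (1 / (2 * a)) ^ j * (a ^ j * a)"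
      using a by (intro mult_left_mono) auto
    have 3: "(1 / (2 * a)) ^ j * (a ^ j * a) = a * (1 / 2) ^ j"
      using a by (simp add: power_divide power_mult_distrib)
    have "?l = \<Phi> (a powr (k + 1)) * ennreal (1 / a powr k * y)"
      using True K(3)[of k] y by (simp add: ennreal_mult[symmetric])
    also have "\<dots> \<le> (ennreal ((1 / (2 * a)) ^ j) * \<Phi> (a * y)) * ennreal (1 / a powr k * y)"
      by (intro mult_right_mono 1) simp
    also have "\<dots> = ennreal ((1 / (2 * a)) ^ j * (1 / a powr k * y)) * \<Phi> (a * y)"
      using a y by (subst ennreal_mult) (auto simp: mult_ac)
    also have "\<dots> \<le> ennreal (a * (1 / 2) ^ j) * \<Phi> (a * y)"
      using 2 3 by (intro mult_right_mono ennreal_leI) auto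
    finally show ?thesis using True by (simp add: j_def)
  next
    case False
    then show ?thesis using K(3)[of k] by simp
  qed
  have "(\<Sum>i. \<Phi> (a powr (int_decode i + 1)) *
      (ennreal (1 / a powr int_decode i) * (ennreal y * indicator {z. a powr int_decode i < z} y)))
    \<le> (\<Sum>i. (if int_decode i \<le> K then ennreal (a * (1 / 2) ^ nat (K - int_decode i)) else 0) * \<Phi> (a * y))"
    by (intro suminf_le bound) auto
  also have "\<dots> = (\<Sum>i. (if int_decode i \<le> K then ennreal (a * (1 / 2) ^ nat (K - int_decode i)) else 0)) * \<Phi> (a * y)"
    by (rule ennreal_suminf_multc)
  also have "\<dots> = ennreal (2 * a) * \<Phi> (a * y)"
    using a by (subst suminf_int_decode_geometric) auto
  finally show ?thesis .
qed simp

text \<open>For finite positive \<open>m\<close> a single summand suffices: the level that brackets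
  \<open>m / 2\<close>. If \<open>m\<close> is infinite, all indicators are 1 and the summands are
  unbounded, since \<Phi> tends to \<infinity>. The half in the argument matches the level
  \<open>2 * t\<close> of the weak type estimate.\<close>

lemma young_ext_layer_le:
  assumes "young \<Phi>" "1 < a"
  shows "young_ext \<Phi> (enn2ereal m / 2) \<le>
    (\<Sum>i. \<Phi> (a powr (int_decode i + 1)) * indicator {z. ennreal (2 * a powr int_decode i) < z} m)"
proof -
  define w where "w i = \<Phi> (a powr (int_decode i + 1)) * indicator {z. ennreal (2 * a powr int_decode i) < z} m" for i
  have single: "w i \<le> suminf w" for i
    using sum_le_suminf[of w "{i}"] by simp
  show ?thesis
  proof (cases m)
    case top
    have large: "ennreal N \<le> suminf w" for N
    proof -
      obtain r where r: "0 \<le> r" "ennreal N < \<Phi> r"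
        using young_inv_set_nonempty[OF assms(1), of N] by auto
      define k where "k = \<lceil>log a (max r 1)\<rceil>"
      have "max r 1 = a powr (log a (max r 1))" using assms by simp
      also have "\<dots> \<le> a powr (k + 1)" using assms by (intro powr_mono) (auto simp: k_def, linarith)
      finally have "\<Phi> r \<le> \<Phi> (a powr (k + 1))"
        using r by (intro young_mono[OF assms(1)]) auto
      also have "\<dots> = w (int_encode k)" using top by (simp add: w_def)
      also have "\<dots> \<le> suminf w" by (rule single)
      finally show ?thesis using r by simp
    qed
    have "\<not> suminf w < top"
    proof
      assume "suminf w < top"
      then obtain q where "0 \<le> q" "suminf w = ennreal q" by (cases "suminf w") auto
      then show False using large[of "q + 1"] by simp
    qed
    then have "suminf w = top" by (simp add: less_top[symmetric])
    then show ?thesis unfolding w_def by simp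
  next
    case (real u)
    have ext: "young_ext \<Phi> (enn2ereal m / 2) = \<Phi> (u / 2)"
      using real by (simp add: young_ext_def)
    show ?thesis
    proof (cases "u = 0")
      case True
      then show ?thesis using ext assms(1) by (simp add: young_def)
    next
      case False
      then have "0 < u / 2" using real by simp
      then obtain k where k: "a powr real_of_int k < u / 2" "u / 2 \<le> a powr (real_of_int k + 1)"
        using powr_bracket[OF assms(2)] by blast
      have "\<Phi> (u / 2) \<le> \<Phi> (a powr (k + 1))"
        using k real by (intro young_mono[OF assms(1)]) auto
      also have "\<dots> = w (int_encode k)" using k real by (simp add: w_def ennreal_less_iff)
      also have "\<dots> \<le> suminf w" by (rule single)
      finally show ?thesis using ext unfolding w_def by simp
    qed
  qed
qed

text \<open>Marcinkiewicz interpolation for modulars: cut the maximal function into levels, apply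
  the weak type bound on each, exchange sum and integral, and sum the truncations of
  \<open>F\<close> pointwise by \<open>nabla2_layer_sum\<close>.\<close>

lemma maximal_strong_type_modular:
  fixes F :: "'a::euclidean_space \<Rightarrow> real"
  assumes "young \<Phi>" "1 < a" "\<And>r. 0 \<le> r \<Longrightarrow> \<Phi> r \<le> ennreal (1 / (2 * a)) * \<Phi> (a * r)"
    and F[measurable]: "F \<in> borel_measurable lebesgue" and F0: "\<And>x. 0 \<le> F x"
  shows "(\<integral>\<^sup>+x. young_ext \<Phi> (enn2ereal (frac_max 0 F x) / 2) \<partial>lebesgue) \<le>
    ennreal (5 ^ DIM('a)) * (ennreal (2 * a) * (\<integral>\<^sup>+x. \<Phi> (a * F x) \<partial>lebesgue))"
proof -
  have a: "0 < a" using assms by simp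
  define A where "A i = \<Phi> (a powr (int_decode i + 1))" for i
  define p where "p i = a powr int_decode i" for i
  have p: "0 < p i" for i using a by (simp add: p_def)
  have [measurable]: "{x. t < frac_max 0 F x} \<in> sets lebesgue" for t
    using open_frac_max_superlevel[of t 0 F] by (simp add: borel_open)
  have "{y \<in> space lebesgue. t < F y} \<in> sets lebesgue" for t by measurable
  then have [measurable]: "{y. t < F y} \<in> sets lebesgue" for t by simp
  have [measurable]: "(\<lambda>x. \<Phi> (a * F x)) \<in> borel_measurable lebesgue"
    by (rule borel_measurable_young[OF assms(1)]) (use a F0 in auto)
  have "(\<integral>\<^sup>+x. young_ext \<Phi> (enn2ereal (frac_max 0 F x) / 2) \<partial>lebesgue) \<le>
      (\<integral>\<^sup>+x. (\<Sum>i. A i * indicator {x. ennreal (2 * p i) < frac_max 0 F x} x) \<partial>lebesgue)"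
    unfolding A_def p_def
    by (intro nn_integral_mono order_trans[OF young_ext_layer_le[OF assms(1,2)]] suminf_le)
      (auto split: split_indicator)
  also have "\<dots> = (\<Sum>i. A i * emeasure lebesgue {x. ennreal (2 * p i) < frac_max 0 F x})"
    by (simp add: nn_integral_suminf nn_integral_cmult_indicator)
  also have "\<dots> \<le> (\<Sum>i. A i * (ennreal (5 ^ DIM('a) / p i) *
      (\<integral>\<^sup>+x. ennreal (F x) * indicator {y. p i < F y} x \<partial>lebesgue)))"
    by (intro suminf_le mult_left_mono maximal_weak_type F F0 p) auto
  also have "\<dots> = (\<Sum>i. (\<integral>\<^sup>+x. ennreal (5 ^ DIM('a)) * (A i * (ennreal (1 / p i) *
      (ennreal (F x) * indicator {y. p i < F y} x))) \<partial>lebesgue))"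
  proof (intro arg_cong[where f = suminf] ext)
    fix i
    have "ennreal (5 ^ DIM('a) / p i) = ennreal (5 ^ DIM('a)) * ennreal (1 / p i)"
      using p[of i] by (simp add: ennreal_mult[symmetric])
    then have *: "A i * (ennreal (5 ^ DIM('a) / p i) * X) =
        ennreal (5 ^ DIM('a)) * (A i * (ennreal (1 / p i) * X))" for X
      by (simp only: mult_ac)
    show "A i * (ennreal (5 ^ DIM('a) / p i) *
      (\<integral>\<^sup>+x. ennreal (F x) * indicator {y. p i < F y} x \<partial>lebesgue)) =
      (\<integral>\<^sup>+x. ennreal (5 ^ DIM('a)) * (A i * (ennreal (1 / p i) *
      (ennreal (F x) * indicator {y. p i < F y} x))) \<partial>lebesgue)"
      unfolding * by (simp add: nn_integral_cmult)
  qed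
  also have "\<dots> = (\<integral>\<^sup>+x. (\<Sum>i. ennreal (5 ^ DIM('a)) * (A i * (ennreal (1 / p i) *
      (ennreal (F x) * indicator {y. p i < F y} x)))) \<partial>lebesgue)"
    by (intro nn_integral_suminf[symmetric]) measurable
  also have "\<dots> \<le> (\<integral>\<^sup>+x. ennreal (5 ^ DIM('a)) * (ennreal (2 * a) * \<Phi> (a * F x)) \<partial>lebesgue)"
  proof (intro nn_integral_mono)
    fix x
    have "(\<Sum>i. A i * (ennreal (1 / p i) * (ennreal (F x) * indicator {y. p i < F y} x))) \<le> ennreal (2 * a) * \<Phi> (a * F x)"
      using nabla2_layer_sum[OF assms(1-3) F0[of x]] by (simp add: A_def p_def indicator_def)
    then show "(\<Sum>i. ennreal (5 ^ DIM('a)) * (A i * (ennreal (1 / p i) *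
      (ennreal (F x) * indicator {y. p i < F y} x)))) \<le> ennreal (5 ^ DIM('a)) * (ennreal (2 * a) * \<Phi> (a * F x))"
      by (subst ennreal_suminf_cmult) (intro mult_left_mono, auto)
  qed
  also have "\<dots> = ennreal (5 ^ DIM('a)) * (ennreal (2 * a) * (\<integral>\<^sup>+x. \<Phi> (a * F x) \<partial>lebesgue))"
    by (simp add: nn_integral_cmult)
  finally show ?thesis .
qed

lemma frac_max_cmult:
  fixes f :: "'a::euclidean_space \<Rightarrow> real"
  assumes [measurable]: "f \<in> borel_measurable lebesgue" and "0 \<le> c"
  shows "frac_max \<alpha> (\<lambda>x. c * f x) x = ennreal c * frac_max \<alpha> f x"
proof -
  have eq: "ennreal w * (\<integral>\<^sup>+y\<in>B. ennreal \<bar>c * f y\<bar> \<partial>lebesgue) =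
    ennreal c * (ennreal w * (\<integral>\<^sup>+y\<in>B. ennreal \<bar>f y\<bar> \<partial>lebesgue))" if "B \<in> balls" for B :: "'a set" and w
  proof -
    have [measurable]: "B \<in> sets lebesgue" using that by (rule balls_imp_vol_pos)
    have "(\<integral>\<^sup>+y\<in>B. ennreal \<bar>c * f y\<bar> \<partial>lebesgue) =
        (\<integral>\<^sup>+y. ennreal c * (ennreal \<bar>f y\<bar> * indicator B y) \<partial>lebesgue)"
      using assms(2) by (intro nn_integral_cong) (simp add: abs_mult ennreal_mult mult.assoc)
    also have "\<dots> = ennreal c * (\<integral>\<^sup>+y\<in>B. ennreal \<bar>f y\<bar> \<partial>lebesgue)"
      by (rule nn_integral_cmult) measurable
    finally show ?thesis by (simp only: mult.left_commute)
  qed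
  show ?thesis
    unfolding frac_max_def SUP_mult_left_ennreal by (intro SUP_cong refl eq) auto
qed

theorem maximal_strong_type:
  assumes "young \<Phi>" "\<Phi> \<in> nabla2"
  obtains c :: real where "0 < c"
    "\<And>F :: 'a::euclidean_space \<Rightarrow> real. F \<in> borel_measurable lebesgue \<Longrightarrow> (\<And>x. 0 \<le> F x) \<Longrightarrow>
       (\<integral>\<^sup>+x. \<Phi> (F x) \<partial>lebesgue) \<le> 1 \<Longrightarrow>
       (\<integral>\<^sup>+x. young_ext \<Phi> (ereal c * enn2ereal (frac_max 0 F x)) \<partial>lebesgue) \<le> 1"
proof -
  obtain a where a: "1 < a" "\<And>r. 0 \<le> r \<Longrightarrow> \<Phi> r \<le> ennreal (1 / (2 * a)) * \<Phi> (a * r)"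
    using assms(2) by (auto simp: nabla2_def)
  define D where "D = 5 ^ DIM('a) * (2 * a)"
  have D: "1 \<le> D"
    unfolding D_def using a mult_mono[of 1 "5 ^ DIM('a)" 1 "2 * a"] by simp
  \<comment> \<open>The choice gives \<open>a * e = 1 / D\<close>. By convexity \<Phi>(F/D) is at
    most \<Phi>(F)/D, which cancels the factor \<open>D\<close> of the modular estimate. The
    additional half in \<open>e / 2\<close> is the one inside that estimate.\<close>
  define e where "e = 1 / (D * a)"
  have e: "0 < e" "a * e = 1 / D" using a D by (auto simp: e_def)
  show ?thesis
  proof (rule that[of "e / 2"])
    show "0 < e / 2" using e by simp
    fix F :: "'a \<Rightarrow> real"
    assume F[measurable]: "F \<in> borel_measurable lebesgue" and F0: "\<And>x. 0 \<le> F x"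
      and le: "(\<integral>\<^sup>+x. \<Phi> (F x) \<partial>lebesgue) \<le> 1"
    have [measurable]: "(\<lambda>x. \<Phi> (F x)) \<in> borel_measurable lebesgue"
      by (rule borel_measurable_young[OF assms(1) F F0])
    have "enn2ereal (frac_max 0 (\<lambda>x. e * F x) x) / 2 = ereal (e / 2) * enn2ereal (frac_max 0 F x)" for x
    proof -
      have "enn2ereal (frac_max 0 (\<lambda>x. e * F x) x) = ereal e * enn2ereal (frac_max 0 F x)"
        using e by (simp add: frac_max_cmult[OF F] times_ennreal.rep_eq enn2ereal_ennreal)
      then show ?thesis using e
        by (cases "frac_max 0 F x") (auto simp: enn2ereal_ennreal)
    qed
    then have "(\<integral>\<^sup>+x. young_ext \<Phi> (ereal (e / 2) * enn2ereal (frac_max 0 F x)) \<partial>lebesgue) =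
       (\<integral>\<^sup>+x. young_ext \<Phi> (enn2ereal (frac_max 0 (\<lambda>x. e * F x) x) / 2) \<partial>lebesgue)"
      by simp
    also have "\<dots> \<le> ennreal (5 ^ DIM('a)) * (ennreal (2 * a) * (\<integral>\<^sup>+x. \<Phi> (a * (e * F x)) \<partial>lebesgue))"
      by (rule maximal_strong_type_modular[OF assms(1) a]) (use e F0 in auto)
    also have "\<dots> = ennreal D * (\<integral>\<^sup>+x. \<Phi> (1 / D * F x) \<partial>lebesgue)"
    proof -
      have "a * (e * F x) = 1 / D * F x" for x using e(2) by (metis mult.assoc)
      moreover have "ennreal D = ennreal (5 ^ DIM('a)) * ennreal (2 * a)"
        unfolding D_def using a by (intro ennreal_mult) auto
      ultimately show ?thesis by (simp only: mult.assoc)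
    qed
    also have "\<dots> \<le> ennreal D * (\<integral>\<^sup>+x. ennreal (1 / D) * \<Phi> (F x) \<partial>lebesgue)"
      by (intro mult_left_mono nn_integral_mono young_scale_le[OF assms(1)] F0) (use D in auto)
    also have "\<dots> = ennreal D * ennreal (1 / D) * (\<integral>\<^sup>+x. \<Phi> (F x) \<partial>lebesgue)"
      by (simp add: nn_integral_cmult mult.assoc)
    also have "ennreal D * ennreal (1 / D) = 1"
      using D by (simp add: ennreal_mult[symmetric])
    finally show "(\<integral>\<^sup>+x. young_ext \<Phi> (ereal (e / 2) * enn2ereal (frac_max 0 F x)) \<partial>lebesgue) \<le> 1"
      using le by (simp add: order_trans)
  qed
qed

section \<open>Campanato functions\<close>

definition ball_avg :: "('a::euclidean_space \<Rightarrow> real) \<Rightarrow> 'a set \<Rightarrow> real" where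
  "ball_avg f B = (LINT y:B|lebesgue. f y) / vol B"

lemma set_integrable_abs_diff_const:
  assumes "locally_integrable (f :: 'a::euclidean_space \<Rightarrow> real)"
  shows "set_integrable lebesgue (ball c r) (\<lambda>y. f y - m)"
    "set_integrable lebesgue (ball c r) (\<lambda>y. \<bar>f y - m\<bar>)"
proof -
  have "set_integrable lebesgue (ball c r) (\<lambda>_. m)"
    unfolding set_integrable_def using emeasure_ball_eq_vol[of c r]
    by (intro integrable_scaleR_left) (auto simp: less_top[symmetric])
  then show *: "set_integrable lebesgue (ball c r) (\<lambda>y. f y - m)"
    by (rule set_integral_diff(1)[OF locally_integrable_ball[OF assms]])
  show "set_integrable lebesgue (ball c r) (\<lambda>y. \<bar>f y - m\<bar>)"
    using set_integrable_abs[OF *] by simp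
qed

lemma set_integral_diff_const:
  assumes "locally_integrable (f :: 'a::euclidean_space \<Rightarrow> real)" "0 < r"
  shows "(LINT y:ball c r|lebesgue. f y - m) = vol (ball c r) * (ball_avg f (ball c r) - m)"
proof -
  have i: "set_integrable lebesgue (ball c r) (\<lambda>_. m)"
    unfolding set_integrable_def using emeasure_ball_eq_vol[of c r]
    by (intro integrable_scaleR_left) (auto simp: less_top[symmetric])
  have "(LINT y:ball c r|lebesgue. m) = vol (ball c r) * m"
    by (simp add: set_lebesgue_integral_def)
  then show ?thesis
    using vol_ball_pos[OF assms(2), of c]
    by (simp add: set_integral_diff(2)[OF locally_integrable_ball[OF assms(1)] i] ball_avg_def field_simps)
qed

lemma ball_avg_diff_le:
  assumes li: "locally_integrable (f :: 'a::euclidean_space \<Rightarrow> real)"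
    and "0 < \<rho>" "ball x \<rho> \<subseteq> ball y r"
  shows "vol (ball x \<rho>) * \<bar>ball_avg f (ball x \<rho>) - m\<bar> \<le> (LINT z:ball y r|lebesgue. \<bar>f z - m\<bar>)"
proof -
  have "vol (ball x \<rho>) * \<bar>ball_avg f (ball x \<rho>) - m\<bar> = \<bar>LINT z:ball x \<rho>|lebesgue. f z - m\<bar>"
    unfolding set_integral_diff_const[OF li assms(2)] by (simp add: abs_mult)
  also have "\<dots> \<le> (LINT z:ball x \<rho>|lebesgue. \<bar>f z - m\<bar>)"
    using set_integral_norm_bound[OF set_integrable_abs_diff_const(1)[OF li]] by simp
  also have "\<dots> \<le> (LINT z:ball y r|lebesgue. \<bar>f z - m\<bar>)"
    using set_integrable_abs_diff_const(2)[OF li] assms(3)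
    unfolding set_lebesgue_integral_def set_integrable_def
    by (intro integral_mono) (auto split: split_indicator)
  finally show ?thesis .
qed

context
  fixes f :: "'a::euclidean_space \<Rightarrow> real" and C \<beta> :: real
  assumes li: "locally_integrable f" and \<beta>: "0 < \<beta>"
    and osc: "\<And>c r. 0 < r \<Longrightarrow>
      (LINT z:ball c r|lebesgue. \<bar>f z - ball_avg f (ball c r)\<bar>) \<le> C * vol (ball c r) * r powr \<beta>"
begin

lemma campanato_const_nonneg: "0 \<le> C"
proof -
  have "0 \<le> (LINT z:ball 0 1|lebesgue. \<bar>f z - ball_avg f (ball 0 1)\<bar>)"
    unfolding set_lebesgue_integral_def by (intro integral_nonneg_AE) auto
  also have "\<dots> \<le> C * vol (ball (0::'a) 1)" using osc[of 1 0] by simp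
  finally show ?thesis using vol_ball_pos[of 1 "0::'a"] by (simp add: zero_le_mult_iff)
qed

text \<open>The difference of the two averages is at most the oscillation over the larger ball
  divided by the smaller volume. The condition \<open>r \<le> 2 * \<rho>\<close> bounds the ratio of
  the volumes by 2^n.\<close>

lemma campanato_step:
  assumes "0 < \<rho>" "ball x \<rho> \<subseteq> ball y r" "r \<le> 2 * \<rho>"
  shows "\<bar>ball_avg f (ball x \<rho>) - ball_avg f (ball y r)\<bar> \<le> 2 ^ DIM('a) * C * r powr \<beta>"
proof -
  have r: "0 < r"
  proof -
    have "x \<in> ball y r" using assms centre_in_ball[of x \<rho>] by blast
    then show ?thesis using zero_le_dist[of y x] unfolding mem_ball by linarith
  qed
  have v: "0 < vol (ball x \<rho>)" using assms by (simp add: vol_ball_pos)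
  have "vol (ball x \<rho>) * \<bar>ball_avg f (ball x \<rho>) - ball_avg f (ball y r)\<bar> \<le> C * vol (ball y r) * r powr \<beta>"
    using ball_avg_diff_le[OF li assms(1,2)] osc[OF r] by (rule order_trans)
  also have "\<dots> \<le> C * (2 ^ DIM('a) * vol (ball x \<rho>)) * r powr \<beta>"
  proof -
    have "vol (ball y r) \<le> vol (ball x (2 * \<rho>))"
      using r assms power_mono[of r "2 * \<rho>" "DIM('a)"] by (simp add: vol_ball)
    also have "\<dots> = 2 ^ DIM('a) * vol (ball x \<rho>)" by (rule vol_ball_mult) (use assms in auto)
    finally show ?thesis
      using campanato_const_nonneg by (intro mult_right_mono mult_left_mono) auto
  qed
  finally have "vol (ball x \<rho>) * \<bar>ball_avg f (ball x \<rho>) - ball_avg f (ball y r)\<bar> \<le>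
      vol (ball x \<rho>) * (2 ^ DIM('a) * C * r powr \<beta>)" by (simp add: mult_ac)
  then show ?thesis using v by simp
qed

text \<open>The geometric series with first term \<open>2 ^ DIM('a) * C\<close> and ratio
  \<open>(1 / 2) powr \<beta>\<close>: the total drift of the averages when the radius is halved
  indefinitely.\<close>

definition "campanato_K = 2 ^ DIM('a) * C / (1 - (1 / 2) powr \<beta>)"

lemma campanato_K: "0 \<le> campanato_K" "campanato_K * (1 / 2) powr \<beta> + 2 ^ DIM('a) * C = campanato_K"
  "2 ^ DIM('a) * C \<le> campanato_K"
proof -
  have h: "(1 / 2 :: real) powr \<beta> < 1" using \<beta> powr_less_mono2[of \<beta> "1/2" 1] by simp
  then show nonneg: "0 \<le> campanato_K" using campanato_const_nonneg by (simp add: campanato_K_def)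
  define D where "D = 2 ^ DIM('a) * C"
  have "D / (1 - q) * q + D = D / (1 - q)" if "q < 1" for q :: real
    using that by (simp add: field_simps)
  from this[OF h] show *: "campanato_K * (1 / 2) powr \<beta> + 2 ^ DIM('a) * C = campanato_K"
    by (simp only: campanato_K_def D_def)
  have "0 \<le> campanato_K * (1 / 2) powr \<beta>" using nonneg by simp
  then show "2 ^ DIM('a) * C \<le> campanato_K" using * by linarith
qed

text \<open>Induction on the number of halvings between \<open>r\<close> and \<rho>. The bound does
  not deteriorate with \<open>m\<close>, because one more halving reproduces
  \<open>campanato_K\<close> by its fixed point identity \<open>campanato_K(2)\<close>. The exponent
  \<open>Suc m\<close> makes the base case a single \<open>campanato_step\<close>.\<close>

lemma campanato_shrink_aux:
  assumes "0 < r" "r / 2 ^ Suc m \<le> \<rho>" "\<rho> \<le> r"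
  shows "\<bar>ball_avg f (ball x \<rho>) - ball_avg f (ball x r)\<bar> \<le> campanato_K * r powr \<beta>"
  using assms
proof (induction m arbitrary: r)
  case 0
  then have "\<bar>ball_avg f (ball x \<rho>) - ball_avg f (ball x r)\<bar> \<le> 2 ^ DIM('a) * C * r powr \<beta>"
    by (intro campanato_step) auto
  also have "\<dots> \<le> campanato_K * r powr \<beta>"
    by (intro mult_right_mono campanato_K(3)) simp
  finally show ?case .
next
  case (Suc m)
  show ?case
  proof (cases "r / 2 \<le> \<rho>")
    case True
    then have "\<bar>ball_avg f (ball x \<rho>) - ball_avg f (ball x r)\<bar> \<le> 2 ^ DIM('a) * C * r powr \<beta>"
      using Suc by (intro campanato_step) auto
    also have "\<dots> \<le> campanato_K * r powr \<beta>"
      by (intro mult_right_mono campanato_K(3)) simp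
    finally show ?thesis .
  next
    case False
    have "\<bar>ball_avg f (ball x \<rho>) - ball_avg f (ball x (r / 2))\<bar> \<le> campanato_K * (r / 2) powr \<beta>"
      using Suc.prems False by (intro Suc.IH) (auto simp: field_simps)
    moreover have "\<bar>ball_avg f (ball x (r / 2)) - ball_avg f (ball x r)\<bar> \<le> 2 ^ DIM('a) * C * r powr \<beta>"
      using Suc.prems by (intro campanato_step) auto
    moreover have "(r / 2) powr \<beta> = (1 / 2) powr \<beta> * r powr \<beta>"
      using Suc.prems by (simp add: powr_mult[symmetric])
    ultimately have "\<bar>ball_avg f (ball x \<rho>) - ball_avg f (ball x r)\<bar> \<le>
        (campanato_K * (1 / 2) powr \<beta> + 2 ^ DIM('a) * C) * r powr \<beta>"
      by (simp add: algebra_simps)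
    then show ?thesis by (simp only: campanato_K(2))
  qed
qed

lemma campanato_shrink:
  assumes "0 < \<rho>" "\<rho> \<le> r"
  shows "\<bar>ball_avg f (ball x \<rho>) - ball_avg f (ball x r)\<bar> \<le> campanato_K * r powr \<beta>"
proof -
  obtain m where "r / \<rho> < 2 ^ m" using real_arch_pow[of 2 "r / \<rho>"] by auto
  also have "(2::real) ^ m \<le> 2 ^ Suc m" by simp
  finally have "r / 2 ^ Suc m \<le> \<rho>" using assms by (simp add: field_simps)
  then show ?thesis using assms by (intro campanato_shrink_aux) auto
qed

text \<open>The limit exists at every point, not merely almost everywhere, since
  \<open>campanato_shrink\<close> makes the averages Cauchy uniformly in \<open>x\<close>.\<close>

definition "campanato_rep x = lim (\<lambda>k. ball_avg f (ball x (1 / real (Suc k))))"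

lemma campanato_rep_tendsto: "(\<lambda>k. ball_avg f (ball x (1 / real (Suc k)))) \<longlonglongrightarrow> campanato_rep x"
proof -
  have "Cauchy (\<lambda>k. ball_avg f (ball x (1 / real (Suc k))))"
  proof (rule metric_CauchyI)
    fix e :: real assume e: "0 < e"
    have "((\<lambda>k. campanato_K * (1 / real (Suc k)) powr \<beta>) \<longlongrightarrow> campanato_K * 0 powr \<beta>) sequentially"
      using \<beta> LIMSEQ_Suc[OF lim_1_over_n]
      by (intro tendsto_mult tendsto_const tendsto_powr') auto
    then have "eventually (\<lambda>k. campanato_K * (1 / real (Suc k)) powr \<beta> < e / 2) sequentially"
      by (rule order_tendstoD) (use e \<beta> in simp)
    then obtain N where N: "campanato_K * (1 / real (Suc N)) powr \<beta> < e / 2"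
      by (auto simp: eventually_sequentially)
    have *: "\<bar>ball_avg f (ball x (1 / real (Suc k))) - ball_avg f (ball x (1 / real (Suc N)))\<bar> < e / 2"
      if "N \<le> k" for k
    proof -
      have "\<bar>ball_avg f (ball x (1 / real (Suc k))) - ball_avg f (ball x (1 / real (Suc N)))\<bar>
        \<le> campanato_K * (1 / real (Suc N)) powr \<beta>"
        using that by (intro campanato_shrink) (auto simp: frac_le)
      then show ?thesis using N by linarith
    qed
    show "\<exists>M. \<forall>m\<ge>M. \<forall>n\<ge>M. dist (ball_avg f (ball x (1 / real (Suc m)))) (ball_avg f (ball x (1 / real (Suc n)))) < e"
    proof (intro exI[of _ N] allI impI)
      fix m n assume "N \<le> m" "N \<le> n"
      from *[OF this(1)] *[OF this(2)]
      show "dist (ball_avg f (ball x (1 / real (Suc m)))) (ball_avg f (ball x (1 / real (Suc n)))) < e"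
        unfolding dist_real_def by linarith
    qed
  qed
  then show ?thesis unfolding campanato_rep_def by (simp add: Cauchy_convergent convergent_LIMSEQ_iff[symmetric])
qed

lemma campanato_rep_avg:
  assumes "0 < r"
  shows "\<bar>campanato_rep x - ball_avg f (ball x r)\<bar> \<le> campanato_K * r powr \<beta>"
proof (rule tendsto_upperbound)
  show "((\<lambda>k. \<bar>ball_avg f (ball x (1 / real (Suc k))) - ball_avg f (ball x r)\<bar>) \<longlongrightarrow>
      \<bar>campanato_rep x - ball_avg f (ball x r)\<bar>) sequentially"
    by (intro tendsto_intros campanato_rep_tendsto)
  have "eventually (\<lambda>k. 1 / real (Suc k) < r) sequentially"
    using LIMSEQ_Suc[OF lim_1_over_n] assms by (rule order_tendstoD)
  then show "eventually (\<lambda>k. \<bar>ball_avg f (ball x (1 / real (Suc k))) - ball_avg f (ball x r)\<bar>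
      \<le> campanato_K * r powr \<beta>) sequentially"
    by eventually_elim (intro campanato_shrink, auto)
qed simp

text \<open>Adds the error of \<open>campanato_rep_avg\<close> at one point to that of
  \<open>campanato_rep_avg_near\<close> at the other; the former is enlarged by
  \<open>2 powr \<beta>\<close> to share the common factor.\<close>

definition "campanato_L = (2 * campanato_K + 2 ^ DIM('a) * C) * 2 powr \<beta>"

lemma campanato_L: "0 \<le> campanato_L"
  unfolding campanato_L_def using campanato_K campanato_const_nonneg by auto

text \<open>The comparison passes through \<open>ball x (2 * r)\<close>, which is centred at
  \<open>x\<close> and contains \<open>ball c r\<close>. The doubled radius causes the factor
  \<open>2 powr \<beta>\<close>.\<close>

lemma campanato_rep_avg_near:
  assumes "0 < r" "dist x c \<le> r"
  shows "\<bar>campanato_rep x - ball_avg f (ball c r)\<bar> \<le> (campanato_K + 2 ^ DIM('a) * C) * 2 powr \<beta> * r powr \<beta>"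
proof -
  have "\<bar>campanato_rep x - ball_avg f (ball x (2 * r))\<bar> \<le> campanato_K * (2 * r) powr \<beta>"
    using assms by (intro campanato_rep_avg) simp
  moreover have "\<bar>ball_avg f (ball c r) - ball_avg f (ball x (2 * r))\<bar> \<le> 2 ^ DIM('a) * C * (2 * r) powr \<beta>"
    using assms by (intro campanato_step) (auto simp: ball_subset_ball_iff dist_commute)
  ultimately have "\<bar>campanato_rep x - ball_avg f (ball c r)\<bar> \<le> (campanato_K + 2 ^ DIM('a) * C) * (2 * r) powr \<beta>"
    by (simp add: algebra_simps)
  then show ?thesis using assms by (simp add: powr_mult mult.assoc)
qed

lemma campanato_rep_lipschitz: "\<bar>campanato_rep x - campanato_rep y\<bar> \<le> campanato_L * norm (x - y) powr \<beta>"
proof (cases "x = y")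
  case False
  define d where "d = norm (x - y)"
  have d: "0 < d" "dist x y = d" using False by (auto simp: d_def dist_norm)
  have p: "d powr \<beta> \<le> 2 powr \<beta> * d powr \<beta>"
    using mult_right_mono[of 1 "2 powr \<beta>" "d powr \<beta>"] \<beta> by (simp add: ge_one_powr_ge_zero)
  have "\<bar>campanato_rep y - ball_avg f (ball y d)\<bar> \<le> campanato_K * d powr \<beta>"
    using d by (intro campanato_rep_avg)
  also have "\<dots> \<le> campanato_K * (2 powr \<beta> * d powr \<beta>)"
    using p campanato_K by (intro mult_left_mono)
  finally have "\<bar>campanato_rep y - ball_avg f (ball y d)\<bar> \<le> campanato_K * (2 powr \<beta> * d powr \<beta>)" .
  moreover have "\<bar>campanato_rep x - ball_avg f (ball y d)\<bar> \<le> (campanato_K + 2 ^ DIM('a) * C) * 2 powr \<beta> * d powr \<beta>"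
    using d by (intro campanato_rep_avg_near) auto
  ultimately have "\<bar>campanato_rep x - campanato_rep y\<bar> \<le> campanato_L * d powr \<beta>"
    by (simp add: campanato_L_def algebra_simps)
  then show ?thesis by (simp add: d_def)
qed simp

lemma campanato_rep_measurable: "campanato_rep \<in> borel_measurable lebesgue"
proof -
  have "continuous_on UNIV campanato_rep"
  proof (intro continuous_at_imp_continuous_on ballI)
    fix x :: 'a
    have "((\<lambda>y. campanato_L * norm (y - x) powr \<beta>) \<longlongrightarrow> campanato_L * 0 powr \<beta>) (at x)"
      using \<beta> by (intro tendsto_mult tendsto_const tendsto_powr')
        (auto intro!: tendsto_norm_zero LIM_zero tendsto_ident_at)
    then have "((\<lambda>y. campanato_L * norm (y - x) powr \<beta>) \<longlongrightarrow> 0) (at x)" using \<beta> by simp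
    then have "((\<lambda>y. campanato_rep y - campanato_rep x) \<longlongrightarrow> 0) (at x)"
      by (rule Lim_null_comparison[rotated]) (simp add: campanato_rep_lipschitz)
    then show "isCont campanato_rep x" by (simp add: isCont_def LIM_zero_iff)
  qed
  then have "campanato_rep \<in> borel_measurable lborel"
    by (simp add: borel_measurable_continuous_onI)
  then show ?thesis by (rule measurable_completion)
qed

text \<open>On a ball both functions are close to the same average, \<open>f\<close> in the mean and
  its representative pointwise. The point is the gain \<open>r powr \<beta>\<close> over the
  volume.\<close>

lemma campanato_rep_integral_diff:
  obtains E where "0 \<le> E"
    "\<And>c r. 0 < r \<Longrightarrow> (\<integral>\<^sup>+x\<in>ball c r. ennreal \<bar>f x - campanato_rep x\<bar> \<partial>lebesgue) \<le> ennreal (E * r powr \<beta> * vol (ball c r))"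
proof
  define Q where "Q = (campanato_K + 2 ^ DIM('a) * C) * 2 powr \<beta>"
  have Q: "0 \<le> Q" using campanato_K campanato_const_nonneg by (simp add: Q_def)
  then show "0 \<le> C + Q" using campanato_const_nonneg by simp
  fix c :: 'a and r :: real assume r: "0 < r"
  let ?m = "ball_avg f (ball c r)"
  have [measurable]: "f \<in> borel_measurable lebesgue" by (rule locally_integrable_measurable[OF li])
  have [measurable]: "ball c r \<in> sets lebesgue" by simp
  have "(\<integral>\<^sup>+x\<in>ball c r. ennreal \<bar>f x - campanato_rep x\<bar> \<partial>lebesgue) \<le>
    (\<integral>\<^sup>+x. ennreal (\<bar>f x - ?m\<bar> * indicator (ball c r) x) + ennreal (Q * r powr \<beta>) * indicator (ball c r) x \<partial>lebesgue)"
  proof (intro nn_integral_mono)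
    fix x
    have "\<bar>f x - campanato_rep x\<bar> \<le> \<bar>f x - ?m\<bar> + Q * r powr \<beta>" if "x \<in> ball c r"
      using campanato_rep_avg_near[OF r, of x c] that by (simp add: Q_def dist_commute)
    then show "ennreal \<bar>f x - campanato_rep x\<bar> * indicator (ball c r) x \<le>
      ennreal (\<bar>f x - ?m\<bar> * indicator (ball c r) x) + ennreal (Q * r powr \<beta>) * indicator (ball c r) x"
      using Q by (auto simp: ennreal_plus[symmetric] simp del: ennreal_plus split: split_indicator intro!: ennreal_leI)
  qed
  also have "\<dots> = (\<integral>\<^sup>+x. ennreal (\<bar>f x - ?m\<bar> * indicator (ball c r) x) \<partial>lebesgue) + ennreal (Q * r powr \<beta>) * ennreal (vol (ball c r))"
    by (subst nn_integral_add) (auto simp: nn_integral_cmult_indicator emeasure_ball_eq_vol)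
  also have "(\<integral>\<^sup>+x. ennreal (\<bar>f x - ?m\<bar> * indicator (ball c r) x) \<partial>lebesgue) =
      ennreal (LINT x:ball c r|lebesgue. \<bar>f x - ?m\<bar>)"
    using set_integrable_abs_diff_const(2)[OF li, of c r ?m]
    by (subst nn_integral_eq_integral) (auto simp: set_integrable_def set_lebesgue_integral_def mult.commute)
  also have "\<dots> \<le> ennreal (C * vol (ball c r) * r powr \<beta>)"
    by (intro ennreal_leI osc r)
  also have "ennreal (C * vol (ball c r) * r powr \<beta>) + ennreal (Q * r powr \<beta>) * ennreal (vol (ball c r))
      = ennreal ((C + Q) * r powr \<beta> * vol (ball c r))"
    using Q campanato_const_nonneg
    by (simp add: ennreal_mult[symmetric] ennreal_plus[symmetric] algebra_simps del: ennreal_plus)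
  finally show "(\<integral>\<^sup>+x\<in>ball c r. ennreal \<bar>f x - campanato_rep x\<bar> \<partial>lebesgue) \<le> ennreal ((C + Q) * r powr \<beta> * vol (ball c r))"
    by (simp add: add_right_mono)
qed

text \<open>This stands in for Lebesgue's differentiation theorem. The measure with density
  \<open>?h\<close> gives a ball of radius \<rho> at most a constant times
  \<open>\<rho> powr \<beta>\<close> times its volume. Covering a bounded ball by balls of one
  radius \<rho>, Vitali bounds its whole mass by a constant times
  \<open>\<rho> powr \<beta>\<close>, which vanishes as \<rho> tends to 0.\<close>

lemma campanato_rep_AE: "AE x in lebesgue. f x = campanato_rep x"
proof -
  let ?h = "\<lambda>x. ennreal \<bar>f x - campanato_rep x\<bar>"
  obtain E where E: "0 \<le> E"
    "\<And>c r. 0 < r \<Longrightarrow> (\<integral>\<^sup>+x\<in>ball c r. ?h x \<partial>lebesgue) \<le> ennreal (E * r powr \<beta> * vol (ball c r))"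
    using campanato_rep_integral_diff by metis
  note [measurable] = locally_integrable_measurable[OF li] campanato_rep_measurable
  have h: "?h \<in> borel_measurable lebesgue" by measurable
  define \<mu> where "\<mu> = density lebesgue ?h"
  have \<mu>: "emeasure \<mu> A = (\<integral>\<^sup>+x\<in>A. ?h x \<partial>lebesgue)" if "A \<in> sets lebesgue" for A
    unfolding \<mu>_def by (rule emeasure_density[OF h that])
  have zero: "(\<integral>\<^sup>+x\<in>ball 0 R. ?h x \<partial>lebesgue) = 0" for R :: real
  proof -
    define V where "V = vol (ball (0::'a) (R + 1))"
    have le: "emeasure \<mu> (ball 0 R) \<le> ennreal (E * 5 powr \<beta> * 5 ^ DIM('a) * V * \<rho> powr \<beta>)"
      if \<rho>: "0 < \<rho>" "\<rho> < 1" for \<rho>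
    proof -
      have "emeasure \<mu> (ball 0 R) \<le> ennreal (E * (5 * \<rho>) powr \<beta> * 5 ^ DIM('a)) * emeasure lebesgue (ball (0::'a) (R + 1))"
      proof (rule vitali_measure_bound[where I = "ball 0 R" and c = "\<lambda>x. x" and r = "\<lambda>_. \<rho>" and R = 1])
        show "sets \<mu> = sets lebesgue" by (simp add: \<mu>_def)
        show "0 < \<rho> \<and> \<rho> \<le> 1" using \<rho> by simp
        show "ball (0::'a) R \<subseteq> (\<Union>i\<in>ball 0 R. ball i \<rho>)" using \<rho> by auto
        show "(\<Union>i\<in>ball (0::'a) R. ball i \<rho>) \<subseteq> ball 0 (R + 1)"
          using \<rho> by (auto simp: dist_norm) (smt (verit) norm_triangle_sub norm_minus_commute)
        fix x :: 'a
        have "emeasure \<mu> (ball x (5 * \<rho>)) \<le> ennreal (E * (5 * \<rho>) powr \<beta> * vol (ball x (5 * \<rho>)))"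
          using E(2)[of "5 * \<rho>" x] \<rho> by (simp add: \<mu>)
        also have "vol (ball x (5 * \<rho>)) = 5 ^ DIM('a) * vol (ball x \<rho>)"
          by (rule vol_ball_mult) (use \<rho> in auto)
        also have "ennreal (E * (5 * \<rho>) powr \<beta> * (5 ^ DIM('a) * vol (ball x \<rho>))) =
            ennreal (E * (5 * \<rho>) powr \<beta> * 5 ^ DIM('a)) * emeasure lebesgue (ball x \<rho>)"
          using E(1) by (simp add: emeasure_ball_eq_vol ennreal_mult[symmetric] mult.assoc)
        finally show "emeasure \<mu> (ball x (5 * \<rho>)) \<le> ennreal (E * (5 * \<rho>) powr \<beta> * 5 ^ DIM('a)) * emeasure lebesgue (ball x \<rho>)" .
      qed auto
      also have "\<dots> = ennreal (E * 5 powr \<beta> * 5 ^ DIM('a) * V * \<rho> powr \<beta>)"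
        using E(1) \<rho> by (simp add: V_def emeasure_ball_eq_vol ennreal_mult[symmetric] powr_mult mult_ac)
      finally show ?thesis .
    qed
    have "emeasure \<mu> (ball 0 R) \<le> 0"
    proof (rule tendsto_lowerbound)
      have "((\<lambda>\<rho>. ennreal (E * 5 powr \<beta> * 5 ^ DIM('a) * V * \<rho> powr \<beta>)) \<longlongrightarrow>
          ennreal (E * 5 powr \<beta> * 5 ^ DIM('a) * V * 0 powr \<beta>)) (at_right 0)"
        using \<beta> by (intro tendsto_ennrealI tendsto_mult tendsto_const tendsto_powr')
          (auto intro!: tendsto_ident_at simp: eventually_at_right_less eventually_at_filter)
      then show "((\<lambda>\<rho>. ennreal (E * 5 powr \<beta> * 5 ^ DIM('a) * V * \<rho> powr \<beta>)) \<longlongrightarrow> 0) (at_right 0)"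
        using \<beta> by simp
      show "eventually (\<lambda>\<rho>. emeasure \<mu> (ball 0 R) \<le> ennreal (E * 5 powr \<beta> * 5 ^ DIM('a) * V * \<rho> powr \<beta>)) (at_right 0)"
        by (rule eventually_mono[OF eventually_at_right_real[OF zero_less_one]]) (auto intro!: le)
    qed simp
    then show ?thesis by (simp add: \<mu>)
  qed
  have "AE x in lebesgue. x \<in> ball 0 (real k) \<longrightarrow> f x = campanato_rep x" for k :: nat
  proof -
    have [measurable]: "ball 0 (real k) \<in> sets (lebesgue :: 'a measure)" by simp
    have "AE x in lebesgue. ?h x * indicator (ball 0 (real k)) x = 0"
      using zero[of "real k"] by (subst (asm) nn_integral_0_iff_AE) auto
    then show ?thesis by eventually_elim (auto split: split_indicator_asm)
  qed
  then have "AE x in lebesgue. \<forall>k::nat. x \<in> ball 0 (real k) \<longrightarrow> f x = campanato_rep x"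
    unfolding AE_all_countable by blast
  then show ?thesis
  proof eventually_elim
    case (elim x)
    obtain k where "norm x < real k" using reals_Archimedean2 by blast
    then have "x \<in> ball 0 (real k)" by simp
    then show ?case using elim by blast
  qed
qed

lemma campanato_imp_lipschitz: "f \<in> lipschitz_space \<beta>"
  unfolding lipschitz_space_def using campanato_rep_AE campanato_rep_lipschitz by blast

end

section \<open>The fractional maximal operator and the commutator\<close>

lemma frac_max_upper:
  fixes f :: "'a::euclidean_space \<Rightarrow> real"
  assumes "B \<in> balls" "x \<in> B"
  shows "ennreal (vol B powr (- 1 + \<alpha> / DIM('a))) * (\<integral>\<^sup>+y\<in>B. ennreal \<bar>f y\<bar> \<partial>lebesgue) \<le> frac_max \<alpha> f x"
  unfolding frac_max_def by (rule SUP_upper) (use assms in simp)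

lemma frac_max_least:
  fixes f :: "'a::euclidean_space \<Rightarrow> real"
  assumes "\<And>B. B \<in> balls \<Longrightarrow> x \<in> B \<Longrightarrow>
    ennreal (vol B powr (- 1 + \<alpha> / DIM('a))) * (\<integral>\<^sup>+y\<in>B. ennreal \<bar>f y\<bar> \<partial>lebesgue) \<le> z"
  shows "frac_max \<alpha> f x \<le> z"
  unfolding frac_max_def by (rule SUP_least) (use assms in auto)

text \<open>Balls of volume at most 1 favour the exponent 0, larger ones the exponent \<gamma>. The
  lemma serves to transfer finiteness to the intermediate order \<alpha>.\<close>

lemma frac_max_le_add:
  fixes f :: "'a::euclidean_space \<Rightarrow> real"
  assumes "0 \<le> \<alpha>" "\<alpha> \<le> \<gamma>"
  shows "frac_max \<alpha> f x \<le> frac_max 0 f x + frac_max \<gamma> f x"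
proof (rule frac_max_least)
  fix B :: "'a set" assume B: "B \<in> balls" "x \<in> B"
  have v: "0 < vol B" by (rule balls_imp_vol_pos[OF B(1)])
  let ?I = "\<integral>\<^sup>+y\<in>B. ennreal \<bar>f y\<bar> \<partial>lebesgue"
  have "vol B powr (- 1 + \<alpha> / DIM('a)) \<le> vol B powr (- 1 + 0 / DIM('a)) + vol B powr (- 1 + \<gamma> / DIM('a))"
  proof (cases "vol B \<le> 1")
    case True
    then have "vol B powr (- 1 + \<alpha> / DIM('a)) \<le> vol B powr (- 1 + 0 / DIM('a))"
      using v assms by (intro powr_mono') auto
    then show ?thesis by (simp add: add_increasing2)
  next
    case False
    then have "vol B powr (- 1 + \<alpha> / DIM('a)) \<le> vol B powr (- 1 + \<gamma> / DIM('a))"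
      using v assms by (intro powr_mono) (auto simp: divide_right_mono)
    then show ?thesis by (simp add: add_increasing)
  qed
  then have "ennreal (vol B powr (- 1 + \<alpha> / DIM('a))) * ?I \<le>
      ennreal (vol B powr (- 1 + 0 / DIM('a)) + vol B powr (- 1 + \<gamma> / DIM('a))) * ?I"
    by (intro mult_right_mono ennreal_leI) auto
  also have "\<dots> = ennreal (vol B powr (- 1 + 0 / DIM('a))) * ?I + ennreal (vol B powr (- 1 + \<gamma> / DIM('a))) * ?I"
    by (subst ennreal_plus) (auto simp: distrib_right)
  also have "\<dots> \<le> frac_max 0 f x + frac_max \<gamma> f x"
    by (intro add_mono frac_max_upper B)
  finally show "ennreal (vol B powr (- 1 + \<alpha> / DIM('a))) * ?I \<le> frac_max 0 f x + frac_max \<gamma> f x" .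
qed

section \<open>Hedberg's inequality\<close>

lemma borel_measurable_frac_max: "frac_max \<alpha> f \<in> borel_measurable lebesgue"
  by (intro borel_measurableI_greater) (simp add: open_frac_max_superlevel borel_open)

lemma young_ext_mono:
  assumes "young \<Phi>" "0 \<le> s" "s \<le> t"
  shows "young_ext \<Phi> s \<le> young_ext \<Phi> t"
proof (cases "t = \<infinity>")
  case False
  then obtain r where t: "t = ereal r" using assms by (cases t) auto
  then obtain q where s: "s = ereal q" using assms by (cases s) auto
  show ?thesis using assms s t by (simp add: young_ext_def young_mono)
qed (simp add: young_ext_def)

text \<open>The integral \<open>i\<close> over a ball of volume \<open>v\<close> has two bounds:
  \<open>q * v\<close> from the maximal function and \<open>2 * v * young_inv \<Phi> (1 / v)\<close>
  from the modular. Small balls, with \<open>p \<le> 1 / v\<close>, use the first together with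
  \<open>c * q \<le> young_inv \<Phi> p\<close>; the others use the second. In both cases the
  comparison of inverses yields \<open>young_inv \<Psi> p\<close>, with constants
  \<open>1 / c\<close> and 2 whose sum covers both.\<close>

lemma hedberg_bound:
  fixes F :: "'a::euclidean_space \<Rightarrow> real"
  assumes "young \<Phi>" "young \<Psi>" "0 \<le> \<gamma>" "0 < c" "0 < C\<^sub>1"
    and C1: "\<And>t. 0 < t \<Longrightarrow> C\<^sub>1 * young_inv \<Phi> t * t powr (- \<gamma> / DIM('a)) \<le> young_inv \<Psi> t"
    and F: "F \<in> borel_measurable lebesgue" "\<And>x. 0 \<le> F x" "(\<integral>\<^sup>+x. \<Phi> (F x) \<partial>lebesgue) \<le> 1"
    and q: "frac_max 0 F x = ennreal q" "0 \<le> q" and p: "\<Phi> (c * q) = ennreal p" "0 < p"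
  shows "frac_max \<gamma> F x \<le> ennreal ((2 + 1 / c) / C\<^sub>1 * young_inv \<Psi> p)"
proof (rule frac_max_least)
  fix B :: "'a set" assume B: "B \<in> balls" "x \<in> B"
  define v where "v = vol B"
  have v: "0 < v" "B \<in> sets lebesgue" "emeasure lebesgue B = ennreal v"
    using balls_imp_vol_pos[OF B(1)] by (auto simp: v_def)
  define s where "s = 1 / v"
  have s: "0 < s" using v by (simp add: s_def)
  have vs: "v powr (\<gamma> / DIM('a)) = s powr (- \<gamma> / DIM('a))"
    using v by (simp add: s_def powr_minus powr_divide inverse_eq_divide)
  have abs: "(\<integral>\<^sup>+y\<in>B. ennreal \<bar>F y\<bar> \<partial>lebesgue) = (\<integral>\<^sup>+y\<in>B. ennreal (F y) \<partial>lebesgue)"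
    using F(2) by simp
  have le1: "(\<integral>\<^sup>+y\<in>B. ennreal (F y) \<partial>lebesgue) \<le> ennreal (2 * v * young_inv \<Phi> s)"
    unfolding s_def by (rule nn_integral_young_average[OF assms(1) F v(2,3,1)])
  then obtain i where i: "(\<integral>\<^sup>+y\<in>B. ennreal (F y) \<partial>lebesgue) = ennreal i" "0 \<le> i"
    by (cases "\<integral>\<^sup>+y\<in>B. ennreal (F y) \<partial>lebesgue") (auto simp: top_unique)
  have u: "0 < young_inv \<Phi> s" "0 < young_inv \<Psi> p"
    using young_inv_pos assms s p by auto
  have i1: "i \<le> 2 * v * young_inv \<Phi> s"
    using le1 i u v by (simp add: ennreal_le_iff)
  have "ennreal (v powr - 1) * ennreal i \<le> ennreal q"
    using frac_max_upper[OF B, of 0 F] q i abs by (simp add: v_def)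
  then have "i / v \<le> q" using i v q by (simp add: ennreal_mult[symmetric] powr_minus divide_inverse mult.commute)
  then have i2: "i \<le> q * v" using v by (simp add: field_simps)
  have split: "v powr (- 1 + \<gamma> / DIM('a)) = v powr (\<gamma> / DIM('a)) / v"
    using v powr_add[of v "- 1" "\<gamma> / DIM('a)"] by (simp add: powr_minus divide_inverse mult.commute)
  have "v powr (- 1 + \<gamma> / DIM('a)) * i \<le> (2 + 1 / c) / C\<^sub>1 * young_inv \<Psi> p"
  proof (cases "p \<le> s")
    case True
    have "c * q \<le> young_inv \<Phi> p"
      by (rule le_young_inv[OF assms(1)]) (use assms q p in auto)
    then have q': "q \<le> 1 / c * young_inv \<Phi> p" using assms(4) by (simp add: field_simps)
    have "v powr (- 1 + \<gamma> / DIM('a)) * i \<le> v powr (- 1 + \<gamma> / DIM('a)) * (q * v)"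
      using i2 by (intro mult_left_mono) auto
    also have "\<dots> = s powr (- \<gamma> / DIM('a)) * q" unfolding split vs using v by simp
    also have "\<dots> \<le> p powr (- \<gamma> / DIM('a)) * (1 / c * young_inv \<Phi> p)"
      using q' q p True assms(3) by (intro mult_mono powr_mono2') auto
    also have "\<dots> = 1 / c / C\<^sub>1 * (C\<^sub>1 * young_inv \<Phi> p * p powr (- \<gamma> / DIM('a)))"
      using assms(5) by simp
    also have "\<dots> \<le> 1 / c / C\<^sub>1 * young_inv \<Psi> p"
      using assms(4,5) p by (intro mult_left_mono C1) auto
    also have "\<dots> \<le> (2 + 1 / c) / C\<^sub>1 * young_inv \<Psi> p"
      using assms(4,5) u by (intro mult_right_mono divide_right_mono) auto
    finally show ?thesis .
  next
    case False
    have "v powr (- 1 + \<gamma> / DIM('a)) * i \<le> v powr (- 1 + \<gamma> / DIM('a)) * (2 * v * young_inv \<Phi> s)"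
      using i1 by (intro mult_left_mono) auto
    also have "\<dots> = 2 / C\<^sub>1 * (C\<^sub>1 * young_inv \<Phi> s * s powr (- \<gamma> / DIM('a)))"
      unfolding split vs using v assms(5) by simp
    also have "\<dots> \<le> 2 / C\<^sub>1 * young_inv \<Psi> s"
      using assms(5) s by (intro mult_left_mono C1) auto
    also have "\<dots> \<le> 2 / C\<^sub>1 * young_inv \<Psi> p"
      using assms(5) False by (intro mult_left_mono young_inv_mono assms) auto
    also have "\<dots> \<le> (2 + 1 / c) / C\<^sub>1 * young_inv \<Psi> p"
      using assms(4,5) u by (intro mult_right_mono divide_right_mono) auto
    finally show ?thesis .
  qed
  then show "ennreal (vol B powr (- 1 + \<gamma> / DIM('a))) * (\<integral>\<^sup>+y\<in>B. ennreal \<bar>F y\<bar> \<partial>lebesgue)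
      \<le> ennreal ((2 + 1 / c) / C\<^sub>1 * young_inv \<Psi> p)"
    unfolding abs i(1) v_def[symmetric] using i(2) by (simp add: ennreal_mult[symmetric] ennreal_leI)
qed

lemma frac_max_eq_0:
  fixes F :: "'a::euclidean_space \<Rightarrow> real"
  assumes "frac_max 0 F x = 0"
  shows "frac_max \<gamma> F x = 0"
proof -
  have "frac_max \<gamma> F x \<le> 0"
  proof (rule frac_max_least)
    fix B :: "'a set" assume B: "B \<in> balls" "x \<in> B"
    have "0 < vol B" by (rule balls_imp_vol_pos[OF B(1)])
    then show "ennreal (vol B powr (- 1 + \<gamma> / DIM('a))) * (\<integral>\<^sup>+y\<in>B. ennreal \<bar>F y\<bar> \<partial>lebesgue) \<le> 0"
      using frac_max_upper[OF B, of 0 F] assms by (auto simp: ennreal_eq_0_iff)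
  qed
  then show ?thesis by simp
qed

text \<open>Hedberg's argument: at the ball volume \<open>1 / \<Phi>(c M F(x))\<close> the estimate by the maximal
  function on small balls and the estimate by the Orlicz norm on large balls balance.\<close>

lemma hedberg_young:
  fixes F :: "'a::euclidean_space \<Rightarrow> real"
  assumes "\<Phi> \<in> young_Y" "young \<Psi>" "0 \<le> \<gamma>" "0 < c" "0 < C\<^sub>1"
    and C1: "\<And>t. 0 < t \<Longrightarrow> C\<^sub>1 * young_inv \<Phi> t * t powr (- \<gamma> / DIM('a)) \<le> young_inv \<Psi> t"
    and F: "F \<in> borel_measurable lebesgue" "\<And>x. 0 \<le> F x" "(\<integral>\<^sup>+x. \<Phi> (F x) \<partial>lebesgue) \<le> 1"
    and fin: "frac_max 0 F x < \<infinity>"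
  shows "young_ext \<Psi> (enn2ereal (frac_max \<gamma> F x) / ereal ((2 + 1 / c) / C\<^sub>1)) \<le>
      young_ext \<Phi> (ereal c * enn2ereal (frac_max 0 F x))" "frac_max \<gamma> F x < \<infinity>"
proof -
  define D where "D = (2 + 1 / c) / C\<^sub>1"
  have D: "0 < D" using assms by (simp add: D_def add_pos_pos)
  have \<Phi>: "young \<Phi>" "\<And>r. 0 < r \<Longrightarrow> 0 < \<Phi> r \<and> \<Phi> r < \<infinity>" using assms by (auto simp: young_Y_def)
  obtain q where q: "frac_max 0 F x = ennreal q" "0 \<le> q"
    using fin by (cases "frac_max 0 F x") auto
  have "young_ext \<Psi> (enn2ereal (frac_max \<gamma> F x) / ereal D) \<le>
      young_ext \<Phi> (ereal c * enn2ereal (frac_max 0 F x)) \<and> frac_max \<gamma> F x < \<infinity>"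
  proof (cases "q = 0")
    case True
    then show ?thesis using q frac_max_eq_0[of F x \<gamma>] assms(2)
      by (simp add: young_ext_def young_def zero_ennreal.rep_eq)
  next
    case False
    then have "0 < c * q" using q assms by simp
    \<comment> \<open>Membership in \<open>young_Y\<close> makes the value positive and finite,
      hence a level at which the inverse functions can be compared.\<close>
    with \<Phi>(2) obtain p where p: "\<Phi> (c * q) = ennreal p" "0 < p"
      by (metis ennreal_cases ennreal_less_zero_iff infinity_ennreal_def less_irrefl)
    have le: "frac_max \<gamma> F x \<le> ennreal (D * young_inv \<Psi> p)"
      unfolding D_def by (rule hedberg_bound[OF \<Phi>(1) assms(2-5) C1 F q p])
    then obtain w where w: "frac_max \<gamma> F x = ennreal w" "0 \<le> w"
      by (cases "frac_max \<gamma> F x") (auto simp: top_unique)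
    have u: "0 < young_inv \<Psi> p" by (rule young_inv_pos[OF assms(2) p(2)])
    have "w \<le> D * young_inv \<Psi> p" using le w D u by (simp add: ennreal_le_iff)
    then have "w / D \<le> young_inv \<Psi> p" using D by (simp add: field_simps)
    then have "\<Psi> (w / D) \<le> \<Psi> (young_inv \<Psi> p)"
      using w D by (intro young_mono[OF assms(2)]) auto
    also have "\<dots> \<le> \<Phi> (c * q)" unfolding p by (rule young_young_inv_le[OF assms(2) p(2)])
    finally show ?thesis using w q D by (simp add: young_ext_def)
  qed
  then show "young_ext \<Psi> (enn2ereal (frac_max \<gamma> F x) / ereal ((2 + 1 / c) / C\<^sub>1)) \<le>
      young_ext \<Phi> (ereal c * enn2ereal (frac_max 0 F x))" "frac_max \<gamma> F x < \<infinity>"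
    unfolding D_def by blast+
qed

section \<open>The commutator with a Lipschitz function\<close>

definition ball_const :: "'a::euclidean_space itself \<Rightarrow> real \<Rightarrow> real" where
  "ball_const _ \<beta> = 2 powr \<beta> / unit_ball_vol DIM('a) powr (\<beta> / DIM('a))"

lemma unit_ball_vol_neq_0: "unit_ball_vol (real n) \<noteq> 0"
  using unit_ball_vol_pos[of "real n"] by linarith

lemma ball_const_pos: "0 < ball_const TYPE('a::euclidean_space) \<beta>"
  by (simp add: ball_const_def unit_ball_vol_neq_0)

text \<open>Points of a ball are within its diameter \<open>2 * r\<close>, and
  \<open>r powr \<beta>\<close> is \<open>vol B powr (\<beta> / DIM('a))\<close> divided by the same
  power of the unit ball volume; this quotient is the origin of \<open>ball_const\<close>.\<close>

lemma norm_powr_le_vol: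
  fixes x y :: "'a::euclidean_space"
  assumes "0 < \<beta>" "B \<in> balls" "x \<in> B" "y \<in> B"
  shows "norm (x - y) powr \<beta> \<le> ball_const TYPE('a) \<beta> * vol B powr (\<beta> / DIM('a))"
proof -
  obtain c r where B: "B = ball c r" "0 < r" using assms by (auto simp: balls_def)
  have "norm (x - y) \<le> 2 * r"
    using assms B dist_triangle2[of x y c] by (auto simp: dist_norm norm_minus_commute)
  then have "norm (x - y) powr \<beta> \<le> (2 * r) powr \<beta>"
    using assms by (intro powr_mono2) auto
  also have "\<dots> = ball_const TYPE('a) \<beta> * vol B powr (\<beta> / DIM('a))"
    using B by (simp add: ball_const_def vol_ball_powr powr_mult unit_ball_vol_neq_0)
  finally show ?thesis .
qed

lemma lipschitz_oscillation:
  fixes b b' :: "'a::euclidean_space \<Rightarrow> real"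
  assumes "0 < \<beta>" "0 \<le> L" "\<And>x y. \<bar>b' x - b' y\<bar> \<le> L * norm (x - y) powr \<beta>"
    and "B \<in> balls" "x \<in> B" "y \<in> B"
  shows "\<bar>b' x - b' y\<bar> \<le> L * ball_const TYPE('a) \<beta> * vol B powr (\<beta> / DIM('a))"
  using assms(3)[of x y] mult_left_mono[OF norm_powr_le_vol[OF assms(1,4-6)] assms(2)] by linarith

text \<open>On a ball through \<open>x\<close> the functions \<open>b\<close> and the constant
  \<open>b x\<close> differ by at most \<open>K * vol B powr (\<beta> / DIM('a))\<close> almost
  everywhere, and this power raises the order of the maximal function from \<alpha> to \<alpha> +
  \<beta>. Two additive inequalities are proved in \<open>ennreal\<close>, one per direction;
  finiteness permits the subtraction only at the end.\<close>

lemma commutator_pointwise_bound: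
  fixes b b' f :: "'a::euclidean_space \<Rightarrow> real"
  assumes "0 < \<beta>" "0 \<le> L" and lip: "\<And>x y. \<bar>b' x - b' y\<bar> \<le> L * norm (x - y) powr \<beta>"
    and ae: "AE x in lebesgue. b x = b' x" and b0: "\<And>x. 0 \<le> b x"
    and [measurable]: "b \<in> borel_measurable lebesgue" "f \<in> borel_measurable lebesgue"
    and x: "b x = b' x" and fin: "frac_max \<alpha> f x < \<infinity>" "frac_max (\<alpha> + \<beta>) f x < \<infinity>"
  shows "\<bar>commutator b \<alpha> f x\<bar> \<le> ereal (L * ball_const TYPE('a) \<beta>) * enn2ereal (frac_max (\<alpha> + \<beta>) f x)"
proof -
  define K where "K = L * ball_const TYPE('a) \<beta>"
  have K: "0 \<le> K" using assms(2) ball_const_pos[where 'a = 'a, of \<beta>] by (simp add: K_def)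
  let ?P = "frac_max \<alpha> f x" and ?Q = "frac_max \<alpha> (\<lambda>y. b y * f y) x" and ?G = "frac_max (\<alpha> + \<beta>) f x"
  define w where "w B = ennreal (vol B powr (- 1 + \<alpha> / DIM('a)))" for B :: "'a set"
  define v where "v B = ennreal (vol B powr (\<beta> / DIM('a)))" for B :: "'a set"
  define I where "I B = (\<integral>\<^sup>+y\<in>B. ennreal \<bar>f y\<bar> \<partial>lebesgue)" for B :: "'a set"
  define J where "J B = (\<integral>\<^sup>+y\<in>B. ennreal \<bar>b y * f y\<bar> \<partial>lebesgue)" for B :: "'a set"
  have wv: "w B * (v B * I B) \<le> ?G" if B: "B \<in> balls" "x \<in> B" for B
  proof -
    have "w B * v B = ennreal (vol B powr (- 1 + (\<alpha> + \<beta>) / DIM('a)))"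
      unfolding w_def v_def
      by (simp add: ennreal_mult[symmetric] powr_add[symmetric] add_divide_distrib algebra_simps)
    then show ?thesis using frac_max_upper[OF B, of "\<alpha> + \<beta>" f]
      unfolding I_def by (simp add: mult.assoc[symmetric])
  qed
  have bounds: "J B \<le> ennreal (b x) * I B + ennreal K * (v B * I B)"
      "ennreal (b x) * I B \<le> J B + ennreal K * (v B * I B)" if B: "B \<in> balls" "x \<in> B" for B
  proof -
    have [measurable]: "B \<in> sets lebesgue" by (rule balls_imp_vol_pos[OF B(1)])
    define z where "z = K * vol B powr (\<beta> / DIM('a))"
    have z: "0 \<le> z" "ennreal z = ennreal K * v B" using K by (simp_all add: z_def v_def ennreal_mult)
    have *: "\<bar>b x - b' y\<bar> \<le> z" if "y \<in> B" for y
      using lipschitz_oscillation[OF assms(1,2) lip B that] x by (simp add: z_def K_def)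
    have "J B \<le> (\<integral>\<^sup>+y. ennreal (b x) * (ennreal \<bar>f y\<bar> * indicator B y) + ennreal z * (ennreal \<bar>f y\<bar> * indicator B y) \<partial>lebesgue)"
      unfolding J_def
    proof (rule nn_integral_mono_AE, use ae in eventually_elim)
      case (elim y)
      have "b y * \<bar>f y\<bar> \<le> b x * \<bar>f y\<bar> + z * \<bar>f y\<bar>" if "y \<in> B"
        unfolding distrib_right[symmetric] using *[OF that] elim by (intro mult_right_mono) auto
      then show ?case using b0 z(1)
        by (auto simp: abs_mult ennreal_mult[symmetric] ennreal_plus[symmetric] simp del: ennreal_plus
            split: split_indicator intro!: ennreal_leI)
    qed
    also have "\<dots> = ennreal (b x) * I B + ennreal K * (v B * I B)"
      by (simp add: nn_integral_add nn_integral_cmult I_def[symmetric] z(2) mult.assoc)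
    finally show "J B \<le> ennreal (b x) * I B + ennreal K * (v B * I B)" .
    have "ennreal (b x) * I B = (\<integral>\<^sup>+y. ennreal (b x) * (ennreal \<bar>f y\<bar> * indicator B y) \<partial>lebesgue)"
      by (simp add: nn_integral_cmult I_def)
    also have "\<dots> \<le> (\<integral>\<^sup>+y. ennreal \<bar>b y * f y\<bar> * indicator B y + ennreal z * (ennreal \<bar>f y\<bar> * indicator B y) \<partial>lebesgue)"
    proof (rule nn_integral_mono_AE, use ae in eventually_elim)
      case (elim y)
      have "b x * \<bar>f y\<bar> \<le> b y * \<bar>f y\<bar> + z * \<bar>f y\<bar>" if "y \<in> B"
        unfolding distrib_right[symmetric] using *[OF that] elim by (intro mult_right_mono) auto
      then show ?case using b0 z(1)
        by (auto simp: abs_mult ennreal_mult[symmetric] ennreal_plus[symmetric] simp del: ennreal_plus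
            split: split_indicator intro!: ennreal_leI)
    qed
    also have "\<dots> = J B + ennreal K * (v B * I B)"
      by (simp add: nn_integral_add nn_integral_cmult I_def[symmetric] J_def[symmetric] z(2) mult.assoc)
    finally show "ennreal (b x) * I B \<le> J B + ennreal K * (v B * I B)" .
  qed
  have Q: "?Q \<le> ennreal (b x) * ?P + ennreal K * ?G"
  proof (rule frac_max_least)
    fix B :: "'a set" assume B: "B \<in> balls" "x \<in> B"
    have "w B * J B \<le> w B * (ennreal (b x) * I B + ennreal K * (v B * I B))"
      by (intro mult_left_mono bounds B) simp
    also have "\<dots> = ennreal (b x) * (w B * I B) + ennreal K * (w B * (v B * I B))"
      by (simp add: distrib_left mult.left_commute)
    also have "\<dots> \<le> ennreal (b x) * ?P + ennreal K * ?G"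
      using frac_max_upper[OF B, of \<alpha> f] by (intro add_mono mult_left_mono wv B) (auto simp: w_def I_def)
    finally show "ennreal (vol B powr (- 1 + \<alpha> / DIM('a))) * (\<integral>\<^sup>+y\<in>B. ennreal \<bar>b y * f y\<bar> \<partial>lebesgue)
        \<le> ennreal (b x) * ?P + ennreal K * ?G"
      by (simp add: w_def J_def)
  qed
  have P: "ennreal (b x) * ?P \<le> ?Q + ennreal K * ?G"
    unfolding frac_max_def[of \<alpha> f x] SUP_mult_left_ennreal
  proof (rule SUP_least)
    fix B assume "B \<in> {B \<in> balls. x \<in> B}"
    then have B: "B \<in> balls" "x \<in> B" by auto
    have "ennreal (b x) * (w B * I B) = w B * (ennreal (b x) * I B)" by (rule mult.left_commute)
    also have "\<dots> \<le> w B * (J B + ennreal K * (v B * I B))"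
      by (intro mult_left_mono bounds B) simp
    also have "\<dots> = w B * J B + ennreal K * (w B * (v B * I B))"
      by (simp add: distrib_left mult.left_commute)
    also have "\<dots> \<le> ?Q + ennreal K * ?G"
      using frac_max_upper[OF B, of \<alpha> "\<lambda>y. b y * f y"] by (intro add_mono mult_left_mono wv B) (auto simp: w_def J_def)
    finally show "ennreal (b x) * (ennreal (vol B powr (- 1 + \<alpha> / DIM('a))) * (\<integral>\<^sup>+y\<in>B. ennreal \<bar>f y\<bar> \<partial>lebesgue))
        \<le> ?Q + ennreal K * ?G"
      by (simp add: w_def I_def)
  qed
  obtain p where p: "?P = ennreal p" "0 \<le> p" using fin by (cases ?P) auto
  obtain g where g: "?G = ennreal g" "0 \<le> g" using fin by (cases ?G) auto
  have Q': "?Q \<le> ennreal (b x * p + K * g)"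
    using Q p g K b0[of x] by (simp add: ennreal_mult[symmetric] ennreal_plus[symmetric] del: ennreal_plus)
  then obtain q where q: "?Q = ennreal q" "0 \<le> q" by (cases ?Q) (auto simp: top_unique)
  have "q \<le> b x * p + K * g" using Q' q p g K b0[of x] by (simp add: ennreal_le_iff del: ennreal_plus)
  moreover have "b x * p \<le> q + K * g"
    using P p g q K b0[of x] by (simp add: ennreal_mult[symmetric] ennreal_plus[symmetric] ennreal_le_iff del: ennreal_plus)
  ultimately show ?thesis
    unfolding commutator_def using p g q b0[of x] K by (simp add: K_def[symmetric])
qed

lemma orlicz_norm_le:
  assumes "0 < l" "(\<integral>\<^sup>+x. young_ext \<Phi> (\<bar>g x\<bar> / ereal l) \<partial>lebesgue) \<le> 1"
  shows "orlicz_norm \<Phi> g \<le> ennreal l"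
  unfolding orlicz_norm_def by (rule INF_lower) (use assms in simp)

text \<open>Dividing by \<open>C\<close> first moves the estimate inside the infimum, so an empty
  set of admissible \<open>l\<close>, where the norm is infinite, is included.\<close>

lemma le_mult_orlicz_norm:
  assumes "0 < C" "\<And>l. 0 < l \<Longrightarrow> (\<integral>\<^sup>+x. young_ext \<Phi> (\<bar>g x\<bar> / ereal l) \<partial>lebesgue) \<le> 1 \<Longrightarrow> N \<le> ennreal (C * l)"
  shows "N \<le> ennreal C * orlicz_norm \<Phi> g"
proof -
  have C: "ennreal C * (ennreal (1 / C) * z) = z" for z
    using assms(1) by (simp add: mult.assoc[symmetric] ennreal_mult[symmetric])
  have "ennreal (1 / C) * N \<le> orlicz_norm \<Phi> g"
    unfolding orlicz_norm_def
  proof (rule INF_greatest, clarsimp)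
    fix l :: real assume l: "0 < l" "(\<integral>\<^sup>+x. young_ext \<Phi> (\<bar>g x\<bar> / ereal l) \<partial>lebesgue) \<le> 1"
    have "ennreal (1 / C) * N \<le> ennreal (1 / C) * ennreal (C * l)"
      by (intro mult_left_mono assms(2) l) simp
    also have "\<dots> = ennreal l" using assms(1) l by (simp add: ennreal_mult[symmetric])
    finally show "ennreal (1 / C) * N \<le> ennreal l" .
  qed
  then have "ennreal C * (ennreal (1 / C) * N) \<le> ennreal C * orlicz_norm \<Phi> g"
    by (intro mult_left_mono) auto
  then show ?thesis by (simp only: C)
qed

lemma orlicz_norm_admissible:
  assumes "orlicz_norm \<Phi> g < ennreal M"
  obtains l where "0 < l" "l < M" "(\<integral>\<^sup>+x. young_ext \<Phi> (\<bar>g x\<bar> / ereal l) \<partial>lebesgue) \<le> 1"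
  using assms unfolding orlicz_norm_def INF_less_iff by (auto simp: ennreal_less_iff)

lemma lipschitz_spaceE:
  assumes "b \<in> lipschitz_space \<beta>"
  obtains b' L where "AE x in lebesgue. b x = b' x" "0 < L" "\<And>x y. \<bar>b' x - b' y\<bar> \<le> L * norm (x - y) powr \<beta>"
proof -
  obtain b' C where *: "AE x in lebesgue. b x = b' x" "\<And>x y. \<bar>b' x - b' y\<bar> \<le> C * norm (x - y) powr \<beta>"
    using assms unfolding lipschitz_space_def by blast
  have "\<bar>b' x - b' y\<bar> \<le> max C 1 * norm (x - y) powr \<beta>" for x y
    using *(2)[of x y] mult_right_mono[of C "max C 1" "norm (x - y) powr \<beta>"] by simp
  then show ?thesis using that[of b' "max C 1"] * by auto
qed

theorem lipschitz_imp_commutator_bounded: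
  fixes b :: "'a::euclidean_space \<Rightarrow> real"
  assumes "0 < \<beta>" "0 \<le> \<alpha>" "locally_integrable b" and b0: "\<And>x. 0 \<le> b x"
    and "\<Phi> \<in> young_Y \<inter> nabla2" "young \<Psi>" "0 < C\<^sub>1"
    and C1: "\<And>t. 0 < t \<Longrightarrow> C\<^sub>1 * young_inv \<Phi> t * t powr (- (\<alpha> + \<beta>) / DIM('a)) \<le> young_inv \<Psi> t"
    and "b \<in> lipschitz_space \<beta>"
  shows "orlicz_bounded \<Phi> \<Psi> (commutator b \<alpha>)"
proof -
  have \<Phi>: "young \<Phi>" "\<Phi> \<in> young_Y" "\<Phi> \<in> nabla2" using assms by (auto simp: young_Y_def)
  note [measurable] = locally_integrable_measurable[OF assms(3)]
  obtain b' L where b': "AE x in lebesgue. b x = b' x" "0 < L" "\<And>x y. \<bar>b' x - b' y\<bar> \<le> L * norm (x - y) powr \<beta>"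
    using lipschitz_spaceE[OF assms(9)] by metis
  obtain c where c: "0 < c"
    "\<And>F :: 'a \<Rightarrow> real. F \<in> borel_measurable lebesgue \<Longrightarrow> (\<And>x. 0 \<le> F x) \<Longrightarrow>
       (\<integral>\<^sup>+x. \<Phi> (F x) \<partial>lebesgue) \<le> 1 \<Longrightarrow>
       (\<integral>\<^sup>+x. young_ext \<Phi> (ereal c * enn2ereal (frac_max 0 F x)) \<partial>lebesgue) \<le> 1"
    using maximal_strong_type[OF \<Phi>(1,3)] by metis
  define K where "K = L * ball_const TYPE('a) \<beta>"
  have K: "0 < K" using b' ball_const_pos[where 'a = 'a, of \<beta>] by (simp add: K_def)
  define D where "D = (2 + 1 / c) / C\<^sub>1"
  have D: "0 < D" using c assms(7) by (simp add: D_def add_pos_pos)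
  have "orlicz_norm \<Psi> (commutator b \<alpha> f) \<le> ennreal (K * D) * orlicz_norm \<Phi> (\<lambda>x. ereal (f x))"
    if f: "f \<in> orlicz_space \<Phi>" for f
  proof (rule le_mult_orlicz_norm)
    show "0 < K * D" using K D by simp
    fix l :: real assume l: "0 < l" "(\<integral>\<^sup>+x. young_ext \<Phi> (\<bar>ereal (f x)\<bar> / ereal l) \<partial>lebesgue) \<le> 1"
    have f_meas[measurable]: "f \<in> borel_measurable lebesgue"
      using f by (auto simp: orlicz_space_def intro: locally_integrable_measurable)
    \<comment> \<open>Normalisation by an admissible \<open>l\<close>, so that the modular of
      \<open>F\<close> is at most 1; maximal functions scale by the same factor.\<close>
    define F where "F x = 1 / l * \<bar>f x\<bar>" for x
    have F: "F \<in> borel_measurable lebesgue" "\<And>x. 0 \<le> F x" "(\<integral>\<^sup>+x. \<Phi> (F x) \<partial>lebesgue) \<le> 1"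
      unfolding F_def using l by (auto simp: young_ext_def)
    have max_f: "enn2ereal (frac_max \<delta> f x) = ereal l * enn2ereal (frac_max \<delta> F x)" for \<delta> x
    proof -
      have "frac_max \<delta> (\<lambda>x. l * F x) x = ennreal l * frac_max \<delta> F x"
        using F(1) l by (intro frac_max_cmult) auto
      moreover have "frac_max \<delta> (\<lambda>x. l * F x) x = frac_max \<delta> f x"
        using l by (simp add: frac_max_def F_def)
      ultimately show ?thesis using l by (simp add: times_ennreal.rep_eq)
    qed
    have fin_iff: "frac_max \<delta> f x < \<infinity> \<longleftrightarrow> frac_max \<delta> F x < \<infinity>" for \<delta> x
      using max_f[of \<delta> x] l by (cases "frac_max \<delta> f x"; cases "frac_max \<delta> F x") auto
    have modular: "(\<integral>\<^sup>+x. young_ext \<Phi> (ereal c * enn2ereal (frac_max 0 F x)) \<partial>lebesgue) \<le> 1"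
      by (rule c(2)[OF F])
    define A where "A = {x. frac_max 0 F x = \<infinity>}"
    have [measurable]: "A \<in> sets lebesgue"
    proof -
      have "{x \<in> space lebesgue. frac_max 0 F x = \<infinity>} \<in> sets lebesgue"
        using borel_measurable_frac_max[of 0 F] by measurable
      then show ?thesis by (simp add: A_def)
    qed
    \<comment> \<open>On \<open>A\<close> the integrand of \<open>modular\<close> is infinite
      because \<open>c > 0\<close>, so \<open>A\<close> is a null set. Off \<open>A\<close> the
      maximal functions of \<open>f\<close> of orders 0, \<alpha> and \<alpha> + \<beta> are finite,
      as the pointwise bound requires.\<close>
    have "\<infinity> * emeasure lebesgue A = (\<integral>\<^sup>+x. \<infinity> * indicator A x \<partial>lebesgue)"
      by (simp add: nn_integral_cmult_indicator)
    also have "\<dots> \<le> (\<integral>\<^sup>+x. young_ext \<Phi> (ereal c * enn2ereal (frac_max 0 F x)) \<partial>lebesgue)"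
      by (intro nn_integral_mono) (use c(1) in \<open>auto simp: A_def young_ext_def split: split_indicator\<close>)
    also have "\<dots> \<le> 1" by (rule modular)
    finally have "emeasure lebesgue A = 0"
      by (auto simp: ennreal_top_mult top_unique split: if_splits)
    then have "AE x in lebesgue. x \<notin> A"
      by (intro AE_not_in) (simp add: null_sets_def)
    then have "AE x in lebesgue. young_ext \<Psi> (\<bar>commutator b \<alpha> f x\<bar> / ereal (K * D * l)) \<le>
        young_ext \<Phi> (ereal c * enn2ereal (frac_max 0 F x))"
      using b'(1)
    proof eventually_elim
      case (elim x)
      then have fin0: "frac_max 0 F x < \<infinity>" by (simp add: A_def less_top)
      have "0 \<le> \<alpha> + \<beta>" using assms by simp
      note H = hedberg_young[OF \<Phi>(2) assms(6) this c(1) assms(7) C1 F fin0]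
      have fin: "frac_max 0 f x < \<infinity>" "frac_max (\<alpha> + \<beta>) f x < \<infinity>"
        using fin0 H(2) fin_iff by blast+
      moreover have "frac_max \<alpha> f x \<le> frac_max 0 f x + frac_max (\<alpha> + \<beta>) f x"
        using assms by (intro frac_max_le_add) auto
      ultimately have fin\<alpha>: "frac_max \<alpha> f x < \<infinity>"
        by (simp add: le_less_trans)
      have "\<bar>commutator b \<alpha> f x\<bar> \<le> ereal K * enn2ereal (frac_max (\<alpha> + \<beta>) f x)"
        unfolding K_def
        by (rule commutator_pointwise_bound[OF assms(1) less_imp_le[OF b'(2)] b'(3,1) b0 _ _ elim(2) fin\<alpha> fin(2)])
          measurable
      then have "\<bar>commutator b \<alpha> f x\<bar> / ereal (K * D * l) \<le> ereal K * enn2ereal (frac_max (\<alpha> + \<beta>) f x) / ereal (K * D * l)"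
        using K D l by (intro ereal_divide_right_mono) auto
      also have "\<dots> = enn2ereal (frac_max (\<alpha> + \<beta>) F x) / ereal D"
        unfolding max_f using K D l H(2)
        by (cases "frac_max (\<alpha> + \<beta>) F x") (auto simp: field_simps)
      finally have "young_ext \<Psi> (\<bar>commutator b \<alpha> f x\<bar> / ereal (K * D * l)) \<le>
          young_ext \<Psi> (enn2ereal (frac_max (\<alpha> + \<beta>) F x) / ereal D)"
        using K D l by (intro young_ext_mono[OF assms(6)]) auto
      also have "\<dots> \<le> young_ext \<Phi> (ereal c * enn2ereal (frac_max 0 F x))"
        unfolding D_def by (rule H(1))
      finally show ?case .
    qed
    from order_trans[OF nn_integral_mono_AE[OF this] modular]
    show "orlicz_norm \<Psi> (commutator b \<alpha> f) \<le> ennreal (K * D * l)"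
      using K D l by (intro orlicz_norm_le) auto
  qed
  then show ?thesis unfolding orlicz_bounded_def by blast
qed

section \<open>From commutator bounds to mean oscillation\<close>

lemma nn_integral_abs_eq_avg:
  fixes b :: "'a::euclidean_space \<Rightarrow> real"
  assumes "locally_integrable b" "\<And>x. 0 \<le> b x" "0 < r"
  shows "(\<integral>\<^sup>+y\<in>ball c r. ennreal \<bar>b y\<bar> \<partial>lebesgue) = ennreal (vol (ball c r) * ball_avg b (ball c r))"
proof -
  have "(\<integral>\<^sup>+y\<in>ball c r. ennreal \<bar>b y\<bar> \<partial>lebesgue) = (\<integral>\<^sup>+y. ennreal (b y * indicator (ball c r) y) \<partial>lebesgue)"
    using assms(2) by (intro nn_integral_cong) (auto split: split_indicator)
  also have "\<dots> = ennreal (LINT y:ball c r|lebesgue. b y)"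
    using locally_integrable_ball[OF assms(1), of c r] assms(2)
    by (subst nn_integral_eq_integral) (auto simp: set_integrable_def set_lebesgue_integral_def mult.commute)
  also have "(LINT y:ball c r|lebesgue. b y) = vol (ball c r) * ball_avg b (ball c r)"
    using vol_ball_pos[OF assms(3), of c] by (simp add: ball_avg_def)
  finally show ?thesis .
qed

lemma ball_avg_nonneg:
  fixes b :: "'a::euclidean_space \<Rightarrow> real"
  assumes "\<And>x. 0 \<le> b x"
  shows "0 \<le> ball_avg b B"
  unfolding ball_avg_def set_lebesgue_integral_def using assms
  by (intro divide_nonneg_nonneg integral_nonneg_AE) auto

text \<open>With \<open>m\<close> the average and \<open>p\<close> the negative part,
  \<open>\<bar>b - m\<bar> = 2 * p + (b - m)\<close>, and the last term integrates to 0. Averaging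
  \<open>k / l * p\<close> by \<open>nn_integral_young_average\<close> costs a factor 2, and the
  identity another, which gives 4. The function \<open>g\<close> is met only through monotonicity of
  the integral, so it may be any extended real function.\<close>

lemma mean_oscillation_le:
  fixes b :: "'a::euclidean_space \<Rightarrow> real"
  assumes "young \<Psi>" and li: "locally_integrable b" and r: "0 < r" and k: "0 < k"
    and g: "\<And>x. x \<in> ball c r \<Longrightarrow> b x \<le> ball_avg b (ball c r) \<Longrightarrow>
        ereal (k * (ball_avg b (ball c r) - b x)) \<le> \<bar>g x\<bar>"
    and l: "0 < l" "(\<integral>\<^sup>+x. young_ext \<Psi> (\<bar>g x\<bar> / ereal l) \<partial>lebesgue) \<le> 1"
  shows "(LINT x:ball c r|lebesgue. \<bar>b x - ball_avg b (ball c r)\<bar>) \<le>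
    4 * (l / k) * vol (ball c r) * young_inv \<Psi> (1 / vol (ball c r))"
proof -
  define B where "B = ball c r"
  define m where "m = ball_avg b B"
  define v where "v = vol B"
  define p where "p x = max 0 (m - b x)" for x
  define h where "h x = k / l * (p x * indicator B x)" for x
  note [measurable] = locally_integrable_measurable[OF li]
  have [measurable]: "B \<in> sets lebesgue" by (simp add: B_def)
  have v: "0 < v" "emeasure lebesgue B = ennreal v"
    using r by (simp_all add: v_def B_def vol_ball_pos emeasure_ball_eq_vol)
  have h: "h \<in> borel_measurable lebesgue" "\<And>x. 0 \<le> h x"
    unfolding h_def p_def using k l by (measurable, auto)
  have "\<Psi> (h x) \<le> young_ext \<Psi> (\<bar>g x\<bar> / ereal l)" for x
  proof (cases "x \<in> B \<and> b x \<le> m")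
    case True
    then have "ereal (k * (m - b x)) / ereal l \<le> \<bar>g x\<bar> / ereal l"
      using g[of x] l by (intro ereal_divide_right_mono) (auto simp: B_def m_def)
    then have "ereal (h x) \<le> \<bar>g x\<bar> / ereal l"
      using True l by (simp add: h_def p_def max_absorb2)
    then have "young_ext \<Psi> (ereal (h x)) \<le> young_ext \<Psi> (\<bar>g x\<bar> / ereal l)"
      using h by (intro young_ext_mono assms(1)) auto
    then show ?thesis by (simp add: young_ext_def)
  next
    case False
    then have "h x = 0" by (auto simp: h_def p_def)
    then show ?thesis using assms(1) by (simp add: young_def)
  qed
  then have "(\<integral>\<^sup>+x. \<Psi> (h x) \<partial>lebesgue) \<le> (\<integral>\<^sup>+x. young_ext \<Psi> (\<bar>g x\<bar> / ereal l) \<partial>lebesgue)"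
    by (rule nn_integral_mono)
  also have "\<dots> \<le> 1" by (rule l)
  finally have "(\<integral>\<^sup>+x\<in>B. ennreal (h x) \<partial>lebesgue) \<le> ennreal (2 * v * young_inv \<Psi> (1 / v))"
    using h v by (intro nn_integral_young_average[OF assms(1)]) auto
  moreover have ip: "set_integrable lebesgue B p" "set_integrable lebesgue B (\<lambda>x. b x - m)"
      "set_integrable lebesgue B (\<lambda>x. \<bar>b x - m\<bar>)"
  proof -
    show 1: "set_integrable lebesgue B (\<lambda>x. b x - m)" "set_integrable lebesgue B (\<lambda>x. \<bar>b x - m\<bar>)"
      unfolding B_def by (rule set_integrable_abs_diff_const[OF li])+
    have "set_integrable lebesgue B (\<lambda>x. (\<bar>b x - m\<bar> - (b x - m)) / 2)"
      by (intro set_integrable_divide set_integral_diff(1) 1)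
    moreover have "(\<lambda>x. (\<bar>b x - m\<bar> - (b x - m)) / 2) = p" by (auto simp: p_def fun_eq_iff max_def)
    ultimately show "set_integrable lebesgue B p" by simp
  qed
  moreover have "(\<integral>\<^sup>+x\<in>B. ennreal (h x) \<partial>lebesgue) = ennreal (k / l * (LINT x:B|lebesgue. p x))"
  proof -
    have "(\<integral>\<^sup>+x\<in>B. ennreal (h x) \<partial>lebesgue) = (\<integral>\<^sup>+x. ennreal (k / l * (indicator B x * p x)) \<partial>lebesgue)"
      by (intro nn_integral_cong) (auto simp: h_def split: split_indicator)
    also have "\<dots> = ennreal (LINT x|lebesgue. k / l * (indicator B x * p x))"
      using ip(1) k l by (intro nn_integral_eq_integral) (auto simp: set_integrable_def p_def)
    also have "(LINT x|lebesgue. k / l * (indicator B x * p x)) = k / l * (LINT x:B|lebesgue. p x)"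
      by (simp add: set_lebesgue_integral_def)
    finally show ?thesis .
  qed
  moreover have "0 < young_inv \<Psi> (1 / v)" using v by (intro young_inv_pos assms) simp
  ultimately have "k / l * (LINT x:B|lebesgue. p x) \<le> 2 * v * young_inv \<Psi> (1 / v)"
    using v by (simp add: ennreal_le_iff)
  then have P: "(LINT x:B|lebesgue. p x) \<le> 2 * (l / k) * v * young_inv \<Psi> (1 / v)"
    using k l by (simp add: field_simps)
  have "(LINT x:B|lebesgue. \<bar>b x - m\<bar>) = (LINT x:B|lebesgue. 2 * p x + (b x - m))"
    by (intro arg_cong[where f = "\<lambda>f. set_lebesgue_integral lebesgue B f"]) (auto simp: p_def fun_eq_iff max_def)
  also have "\<dots> = 2 * (LINT x:B|lebesgue. p x) + (LINT x:B|lebesgue. b x - m)"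
    using ip by (subst set_integral_add(2)) auto
  also have "(LINT x:B|lebesgue. b x - m) = 0"
    using set_integral_diff_const[OF li r, of c m] by (simp add: B_def m_def)
  finally show ?thesis using P by (simp add: B_def[symmetric] m_def[symmetric] v_def[symmetric])
qed

lemma oscillation_imp_lipschitz:
  fixes b :: "'a::euclidean_space \<Rightarrow> real"
  assumes "locally_integrable b" "0 < \<beta>"
    and "\<And>c r. 0 < r \<Longrightarrow> (LINT x:ball c r|lebesgue. \<bar>b x - ball_avg b (ball c r)\<bar>) \<le>
      C * vol (ball c r) * vol (ball c r) powr (\<beta> / DIM('a))"
  shows "b \<in> lipschitz_space \<beta>"
proof (rule campanato_imp_lipschitz[OF assms(1,2)])
  fix c :: 'a and r :: real assume r: "0 < r"
  show "(LINT x:ball c r|lebesgue. \<bar>b x - ball_avg b (ball c r)\<bar>) \<le>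
      (C * unit_ball_vol DIM('a) powr (\<beta> / DIM('a))) * vol (ball c r) * r powr \<beta>"
    using assms(3)[OF r, of c] by (simp add: vol_ball_powr[OF r] mult_ac)
qed

text \<open>At this value of \<lambda> the modular is \<open>vol B\<close> times \<Phi> at
  \<open>young_inv \<Phi> (1 / vol B)\<close>, which is at most 1 by
  \<open>young_young_inv_le\<close>.\<close>

lemma orlicz_norm_indicator_le:
  assumes "young \<Phi>" "B \<in> balls"
  shows "orlicz_norm \<Phi> (\<lambda>x. ereal (indicator B x)) \<le> ennreal (1 / young_inv \<Phi> (1 / vol B))"
proof (rule orlicz_norm_le)
  let ?u = "young_inv \<Phi> (1 / vol B)"
  note B = balls_imp_vol_pos[OF assms(2)]
  have u: "0 < ?u" using B by (intro young_inv_pos assms) simp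
  then show "0 < 1 / ?u" by simp
  have "(\<integral>\<^sup>+x. young_ext \<Phi> (\<bar>ereal (indicator B x)\<bar> / ereal (1 / ?u)) \<partial>lebesgue) \<le>
      (\<integral>\<^sup>+x. ennreal (1 / vol B) * indicator B x \<partial>lebesgue)"
  proof (rule nn_integral_mono)
    fix x
    show "young_ext \<Phi> (\<bar>ereal (indicator B x)\<bar> / ereal (1 / ?u)) \<le> ennreal (1 / vol B) * indicator B x"
      using young_young_inv_le[OF assms(1), of "1 / vol B"] B u assms(1)
      by (auto simp: young_ext_def young_def split: split_indicator)
  qed
  also have "\<dots> = 1" using B by (simp add: nn_integral_cmult_indicator ennreal_mult[symmetric])
  finally show "(\<integral>\<^sup>+x. young_ext \<Phi> (\<bar>ereal (indicator B x)\<bar> / ereal (1 / ?u)) \<partial>lebesgue) \<le> 1" .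
qed

lemma indicator_in_orlicz_space:
  assumes "\<Phi> \<in> young_Y" "B \<in> balls"
  shows "indicator B \<in> orlicz_space \<Phi>"
proof -
  note B = balls_imp_vol_pos[OF assms(2)]
  have "integrable lebesgue (indicator B :: 'a \<Rightarrow> real)"
    using B by (simp add: less_top[symmetric])
  then have *: "set_integrable lebesgue UNIV (indicator B :: 'a \<Rightarrow> real)"
    by (simp add: set_integrable_def)
  have "locally_integrable (indicator B :: 'a \<Rightarrow> real)"
    unfolding locally_integrable_def
  proof (intro allI impI)
    fix K :: "'a set" assume "compact K"
    then have "K \<in> sets lebesgue" by (simp add: borel_compact)
    then show "set_integrable lebesgue K (indicator B :: 'a \<Rightarrow> real)"
      by (rule set_integrable_subset[OF *]) simp
  qed
  moreover have "(\<integral>\<^sup>+x. \<Phi> (1 * \<bar>indicator B x\<bar>) \<partial>lebesgue) < \<infinity>"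
  proof -
    have "(\<integral>\<^sup>+x. \<Phi> (1 * \<bar>indicator B x\<bar>) \<partial>lebesgue) = (\<integral>\<^sup>+x. \<Phi> 1 * indicator B x \<partial>lebesgue)"
      using assms(1) by (intro nn_integral_cong) (auto simp: young_Y_def young_def split: split_indicator)
    also have "\<dots> = \<Phi> 1 * emeasure lebesgue B" using B by (simp add: nn_integral_cmult_indicator)
    also have "\<dots> < \<infinity>" using B assms(1) by (simp add: young_Y_def ennreal_mult_less_top)
    finally show ?thesis .
  qed
  ultimately show ?thesis unfolding orlicz_space_def using zero_less_one by blast
qed

text \<open>A competitor \<open>A\<close> gives at most
  \<open>vol A powr (- 1 + \<alpha> / DIM('a)) * min (vol A) (vol B)\<close>. This is nondecreasing
  in \<open>vol A\<close> up to \<open>vol B\<close> because \<open>0 \<le> \<alpha>\<close>, and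
  nonincreasing beyond because \<alpha> is below the dimension; \<open>A = B\<close> attains the
  maximum.\<close>

lemma frac_max_indicator:
  fixes B :: "'a::euclidean_space set" and \<alpha> :: real
  assumes "0 \<le> \<alpha>" "\<alpha> < DIM('a)" "B \<in> balls" "x \<in> B"
  shows "frac_max \<alpha> (indicator B) x = ennreal (vol B powr (\<alpha> / DIM('a)))"
proof (rule antisym)
  note B = balls_imp_vol_pos[OF assms(3)]
  have int: "(\<integral>\<^sup>+y\<in>A. ennreal \<bar>indicator B y\<bar> \<partial>lebesgue) = emeasure lebesgue (A \<inter> B)"
    if "A \<in> sets lebesgue" for A
  proof -
    have "(\<integral>\<^sup>+y\<in>A. ennreal \<bar>indicator B y\<bar> \<partial>lebesgue) = (\<integral>\<^sup>+y. indicator (A \<inter> B) y \<partial>lebesgue)"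
      by (intro nn_integral_cong) (auto split: split_indicator)
    then show ?thesis using that B by simp
  qed
  have e: "vol A powr (- 1 + \<alpha> / DIM('a)) * vol A = vol A powr (\<alpha> / DIM('a))" if "A \<in> balls" for A :: "'a set"
    using balls_imp_vol_pos(1)[OF that] powr_add[of "vol A" "- 1" "\<alpha> / DIM('a)"] by (simp add: powr_minus)
  show "frac_max \<alpha> (indicator B) x \<le> ennreal (vol B powr (\<alpha> / DIM('a)))"
  proof (rule frac_max_least)
    fix A :: "'a set" assume A: "A \<in> balls" "x \<in> A"
    note A' = balls_imp_vol_pos[OF A(1)]
    have "emeasure lebesgue (A \<inter> B) \<le> ennreal (min (vol A) (vol B))"
      using emeasure_mono[of "A \<inter> B" A lebesgue] emeasure_mono[of "A \<inter> B" B lebesgue] A' B by (auto simp: min_def)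
    then have "ennreal (vol A powr (- 1 + \<alpha> / DIM('a))) * emeasure lebesgue (A \<inter> B) \<le>
        ennreal (vol A powr (- 1 + \<alpha> / DIM('a))) * ennreal (min (vol A) (vol B))"
      by (intro mult_left_mono) auto
    also have "\<dots> = ennreal (vol A powr (- 1 + \<alpha> / DIM('a)) * min (vol A) (vol B))"
      using A' B by (simp add: ennreal_mult)
    also have "\<dots> \<le> ennreal (vol B powr (\<alpha> / DIM('a)))"
    proof (rule ennreal_leI, cases "vol A \<le> vol B")
      case True
      then show "vol A powr (- 1 + \<alpha> / DIM('a)) * min (vol A) (vol B) \<le> vol B powr (\<alpha> / DIM('a))"
        using A' assms(1) by (simp only: min_absorb1 e[OF A(1)]) (intro powr_mono2, auto)
    next
      case False
      then have "vol A powr (- 1 + \<alpha> / DIM('a)) * vol B \<le> vol B powr (- 1 + \<alpha> / DIM('a)) * vol B"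
        using B assms(2) by (intro mult_right_mono powr_mono2') (auto simp: field_simps)
      then show "vol A powr (- 1 + \<alpha> / DIM('a)) * min (vol A) (vol B) \<le> vol B powr (\<alpha> / DIM('a))"
        using False by (simp only: min_absorb2 e[OF assms(3)])
    qed
    finally show "ennreal (vol A powr (- 1 + \<alpha> / DIM('a))) * (\<integral>\<^sup>+y\<in>A. ennreal \<bar>indicator B y\<bar> \<partial>lebesgue)
        \<le> ennreal (vol B powr (\<alpha> / DIM('a)))"
      unfolding int[OF A'(2)] .
  qed
  have "ennreal (vol B powr (\<alpha> / DIM('a))) = ennreal (vol B powr (- 1 + \<alpha> / DIM('a))) * emeasure lebesgue (B \<inter> B)"
    using B e[OF assms(3)] by (simp add: ennreal_mult[symmetric])
  also have "\<dots> \<le> frac_max \<alpha> (indicator B) x"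
    using frac_max_upper[OF assms(3,4), of \<alpha> "indicator B"] unfolding int[OF B(2)] .
  finally show "ennreal (vol B powr (\<alpha> / DIM('a))) \<le> frac_max \<alpha> (indicator B) x" .
qed

theorem commutator_bounded_imp_lipschitz:
  fixes b :: "'a::euclidean_space \<Rightarrow> real" and \<alpha> \<beta> :: real
  assumes "0 < \<beta>" "0 \<le> \<alpha>" "\<alpha> < DIM('a)" and li: "locally_integrable b" and b0: "\<And>x. 0 \<le> b x"
    and "\<Phi> \<in> young_Y" "young \<Psi>" "0 < C\<^sub>2"
    and C2: "\<And>t. 0 < t \<Longrightarrow> young_inv \<Psi> t \<le> C\<^sub>2 * young_inv \<Phi> t * t powr (- (\<alpha> + \<beta>) / DIM('a))"
    and "orlicz_bounded \<Phi> \<Psi> (commutator b \<alpha>)"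
  shows "b \<in> lipschitz_space \<beta>"
proof -
  have \<Phi>: "young \<Phi>" using assms(6) by (simp add: young_Y_def)
  obtain C0 where C0: "\<And>f. f \<in> orlicz_space \<Phi> \<Longrightarrow>
      orlicz_norm \<Psi> (commutator b \<alpha> f) \<le> ennreal C0 * orlicz_norm \<Phi> (\<lambda>x. ereal (f x))"
    using assms(10) unfolding orlicz_bounded_def by blast
  \<comment> \<open>The constant of \<open>orlicz_bounded\<close> is an arbitrary real, possibly not
    positive.\<close>
  define C where "C = max C0 1"
  have C: "0 < C" by (simp add: C_def)
  show ?thesis
  proof (rule oscillation_imp_lipschitz[OF li assms(1), of "8 * C * C\<^sub>2"])
    fix c :: 'a and r :: real assume r: "0 < r"
    define B where "B = ball c r"
    define v where "v = vol B"
    define m where "m = ball_avg b B"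
    have B: "B \<in> balls" using r by (auto simp: B_def balls_def)
    have v: "0 < v" using balls_imp_vol_pos[OF B] by (simp add: v_def)
    have m: "0 \<le> m" using b0 by (simp add: m_def ball_avg_nonneg)
    have u: "0 < young_inv \<Phi> (1 / v)" using v by (intro young_inv_pos \<Phi>) simp
    have "orlicz_norm \<Psi> (commutator b \<alpha> (indicator B)) \<le> ennreal C0 * orlicz_norm \<Phi> (\<lambda>x. ereal (indicator B x))"
      by (rule C0[OF indicator_in_orlicz_space[OF assms(6) B]])
    also have "\<dots> \<le> ennreal C * ennreal (1 / young_inv \<Phi> (1 / v))"
      unfolding v_def by (intro mult_mono orlicz_norm_indicator_le \<Phi> B) (auto simp: C_def ennreal_leI)
    \<comment> \<open>The norm is an infimum, so an admissible \<open>l\<close> is only available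
      below a strictly larger number. This factor 2, with the 4 of
      \<open>mean_oscillation_le\<close>, gives the 8.\<close>
    also have "\<dots> < ennreal (2 * C / young_inv \<Phi> (1 / v))"
      using C u by (simp add: ennreal_mult[symmetric] ennreal_less_iff divide_strict_right_mono)
    finally obtain l where l: "0 < l" "l < 2 * C / young_inv \<Phi> (1 / v)"
      "(\<integral>\<^sup>+x. young_ext \<Psi> (\<bar>commutator b \<alpha> (indicator B) x\<bar> / ereal l) \<partial>lebesgue) \<le> 1"
      by (rule orlicz_norm_admissible)
    define k where "k = v powr (\<alpha> / DIM('a))"
    have k: "0 < k" using v by (simp add: k_def)
    have "ereal (k * (m - b x)) \<le> \<bar>commutator b \<alpha> (indicator B) x\<bar>" if x: "x \<in> B" "b x \<le> m" for x
    proof -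
      have "ennreal (k * m) = ennreal (vol B powr (- 1 + \<alpha> / DIM('a))) * ennreal (v * m)"
        using v m powr_add[of v "- 1" "\<alpha> / DIM('a)"]
        by (simp add: v_def[symmetric] k_def ennreal_mult[symmetric] powr_minus)
      also have "ennreal (v * m) = (\<integral>\<^sup>+y\<in>B. ennreal \<bar>b y\<bar> \<partial>lebesgue)"
        using nn_integral_abs_eq_avg[OF li b0 r, of c] by (simp add: v_def m_def B_def)
      also have "\<dots> = (\<integral>\<^sup>+y\<in>B. ennreal \<bar>b y * indicator B y\<bar> \<partial>lebesgue)"
        by (intro nn_integral_cong) (auto split: split_indicator)
      also have "ennreal (vol B powr (- 1 + \<alpha> / DIM('a))) * \<dots> \<le> frac_max \<alpha> (\<lambda>y. b y * indicator B y) x"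
        by (rule frac_max_upper[OF B x(1)])
      finally have le: "ennreal (k * m) \<le> frac_max \<alpha> (\<lambda>y. b y * indicator B y) x" .
      have P: "enn2ereal (frac_max \<alpha> (indicator B) x) = ereal k"
        using frac_max_indicator[OF assms(2,3) B x(1)] k by (simp add: k_def v_def)
      show ?thesis
      proof (cases "frac_max \<alpha> (\<lambda>y. b y * indicator B y) x")
        case (real q)
        then have "k * m \<le> q" using le by (simp add: ennreal_le_iff)
        then show ?thesis unfolding commutator_def P using real by (simp add: algebra_simps)
      next
        \<comment> \<open>The commutator is then -\<infinity> and its absolute value \<infinity>, so
          the lower bound holds trivially.\<close>
        case top
        then show ?thesis unfolding commutator_def P by simp
      qed
    qed
    then have "(LINT x:ball c r|lebesgue. \<bar>b x - ball_avg b (ball c r)\<bar>) \<le>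
        4 * (l / k) * v * young_inv \<Psi> (1 / v)"
      unfolding v_def B_def
      by (intro mean_oscillation_le[OF assms(7) li r k _ l(1,3)[unfolded B_def]])
        (auto simp: m_def B_def)
    also have "\<dots> \<le> 4 * ((2 * C / young_inv \<Phi> (1 / v)) / k) * v *
        (C\<^sub>2 * young_inv \<Phi> (1 / v) * (1 / v) powr (- (\<alpha> + \<beta>) / DIM('a)))"
      using l k v young_inv_pos[OF assms(7), of "1 / v"] C u
      by (intro mult_mono C2 divide_right_mono) auto
    \<comment> \<open>The factor \<open>k\<close> from testing on the indicator cancels here, which
      removes \<alpha> and leaves the power of the volume belonging to \<beta>.\<close>
    also have "(1 / v) powr (- (\<alpha> + \<beta>) / DIM('a)) = k * v powr (\<beta> / DIM('a))"
    proof -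
      have "(1 / v) powr (- z) = v powr z" for z using v by (simp add: powr_divide powr_minus)
      from this[of "(\<alpha> + \<beta>) / DIM('a)"] show ?thesis by (simp add: k_def powr_add[symmetric] diff_divide_distrib add_divide_distrib)
    qed
    also have "4 * ((2 * C / young_inv \<Phi> (1 / v)) / k) * v * (C\<^sub>2 * young_inv \<Phi> (1 / v) * (k * v powr (\<beta> / DIM('a))))
        = 8 * C * C\<^sub>2 * v * v powr (\<beta> / DIM('a))"
      using u k by (simp add: field_simps)
    finally show "(LINT x:ball c r|lebesgue. \<bar>b x - ball_avg b (ball c r)\<bar>) \<le>
        8 * C * C\<^sub>2 * vol (ball c r) * vol (ball c r) powr (\<beta> / DIM('a))"
      by (simp add: v_def B_def)
  qed
qed

section \<open>The condition with the local maximal function\<close>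

lemma frac_max_local_upper:
  fixes f :: "'a::euclidean_space \<Rightarrow> real"
  assumes "A \<in> balls" "A \<subseteq> B" "x \<in> A"
  shows "ennreal (vol A powr (- 1 + \<alpha> / DIM('a))) * (\<integral>\<^sup>+y\<in>A. ennreal \<bar>f y\<bar> \<partial>lebesgue) \<le> frac_max_local \<alpha> B f x"
proof -
  have "1 / vol A powr (1 - \<alpha> / DIM('a)) = vol A powr (- (1 - \<alpha> / DIM('a)))"
    unfolding powr_minus by (rule inverse_eq_divide[symmetric])
  then have eq: "vol A powr (- 1 + \<alpha> / DIM('a)) = 1 / vol A powr (1 - \<alpha> / DIM('a))"
    by simp
  show ?thesis
    unfolding frac_max_local_def eq by (rule SUP_upper) (use assms in simp)
qed

text \<open>From above: a competitor \<open>A \<subseteq> B\<close> has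
  \<open>vol A \<le> vol B\<close>, so the normalised weight of its average is at most 1, and the
  average of \<open>b\<close> over \<open>A\<close> is at most \<open>b x + z\<close>. From below:
  \<open>A = B\<close> is a competitor, and its average is at least \<open>b x - z\<close>.\<close>

lemma frac_max_local_bounds:
  fixes b b' :: "'a::euclidean_space \<Rightarrow> real"
  assumes "0 < \<beta>" "0 \<le> \<alpha>" "0 \<le> L" and lip: "\<And>x y. \<bar>b' x - b' y\<bar> \<le> L * norm (x - y) powr \<beta>"
    and ae: "AE x in lebesgue. b x = b' x" and b0: "\<And>x. 0 \<le> b x"
    and [measurable]: "b \<in> borel_measurable lebesgue"
    and B: "B \<in> balls" "x \<in> B" and x: "b x = b' x"
  defines "z \<equiv> L * ball_const TYPE('a) \<beta> * vol B powr (\<beta> / DIM('a))"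
  shows "\<bar>ereal (b x) - ereal (vol B powr (- \<alpha> / DIM('a))) * enn2ereal (frac_max_local \<alpha> B b x)\<bar> \<le> ereal z"
proof -
  let ?M = "frac_max_local \<alpha> B b x"
  have z: "0 \<le> z" using assms(3) ball_const_pos[where 'a = 'a, of \<beta>] by (simp add: z_def)
  define v where "v = vol B"
  note B' = balls_imp_vol_pos[OF B(1)]
  have v: "0 < v" using B' by (simp add: v_def)
  have [measurable]: "B \<in> sets lebesgue" by (rule B')
  have osc: "\<bar>b x - b' y\<bar> \<le> z" if "y \<in> B" for y
    using lipschitz_oscillation[OF assms(1,3) lip B that] x by (simp add: z_def)
  define t where "t = v powr (- \<alpha> / DIM('a))"
  have t: "0 < t" using v by (simp add: t_def)
  have upper: "ennreal t * ?M \<le> ennreal (b x + z)"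
    unfolding frac_max_local_def SUP_mult_left_ennreal
  proof (rule SUP_least)
    fix A assume "A \<in> {A \<in> balls. A \<subseteq> B \<and> x \<in> A}"
    then have A: "A \<in> balls" "A \<subseteq> B" "x \<in> A" by auto
    note A' = balls_imp_vol_pos[OF A(1)]
    define w where "w = vol A"
    have w: "0 < w" "w \<le> v" "emeasure lebesgue A = ennreal w"
      using A' A B' emeasure_mono[of A B lebesgue] by (auto simp: w_def v_def ennreal_le_iff)
    have "(\<integral>\<^sup>+y\<in>A. ennreal \<bar>b y\<bar> \<partial>lebesgue) \<le> (\<integral>\<^sup>+y. ennreal (b x + z) * indicator A y \<partial>lebesgue)"
    proof (rule nn_integral_mono_AE, use ae in eventually_elim)
      case (elim y)
      then show ?case using osc[of y] A b0[of y] by (auto split: split_indicator intro!: ennreal_leI)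
    qed
    also have "\<dots> = ennreal ((b x + z) * w)"
      using A' w b0[of x] z by (simp add: nn_integral_cmult_indicator ennreal_mult)
    finally have "ennreal t * (ennreal (1 / w powr (1 - \<alpha> / DIM('a))) * (\<integral>\<^sup>+y\<in>A. ennreal \<bar>b y\<bar> \<partial>lebesgue))
        \<le> ennreal t * (ennreal (1 / w powr (1 - \<alpha> / DIM('a))) * ennreal ((b x + z) * w))"
      by (intro mult_left_mono) auto
    also have "\<dots> = ennreal (t * (1 / w powr (1 - \<alpha> / DIM('a)) * ((b x + z) * w)))"
      using t w z b0[of x] by (simp add: ennreal_mult[symmetric] del: ennreal_plus)
    also have "t * (1 / w powr (1 - \<alpha> / DIM('a)) * ((b x + z) * w)) = (t * w powr (\<alpha> / DIM('a))) * (b x + z)"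
    proof -
      have "1 / w powr (1 - \<alpha> / DIM('a)) * w = w powr (\<alpha> / DIM('a))"
        using w powr_diff[of w 1 "\<alpha> / DIM('a)"] by simp
      moreover have "t * (X * (Y * w)) = (t * (X * w)) * Y" for X Y
        by (simp only: mult_ac)
      ultimately show ?thesis by metis
    qed
    also have "\<dots> \<le> 1 * (b x + z)"
    proof (rule mult_right_mono)
      have "t * w powr (\<alpha> / DIM('a)) \<le> t * v powr (\<alpha> / DIM('a))"
        using w t assms(2) by (intro mult_left_mono powr_mono2) auto
      also have "\<dots> = 1" using v by (simp add: t_def powr_add[symmetric])
      finally show "t * w powr (\<alpha> / DIM('a)) \<le> 1" .
    qed (use z b0[of x] in auto)
    finally show "ennreal t * (ennreal (1 / vol A powr (1 - \<alpha> / DIM('a))) * (\<integral>\<^sup>+y\<in>A. ennreal \<bar>b y\<bar> \<partial>lebesgue))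
        \<le> ennreal (b x + z)"
      by (simp add: w_def ennreal_leI del: ennreal_plus)
  qed
  have lower: "ennreal (b x) \<le> ennreal t * ?M + ennreal z"
  proof -
    let ?I = "\<integral>\<^sup>+y\<in>B. ennreal \<bar>b y\<bar> \<partial>lebesgue"
    have "ennreal (b x * v) = (\<integral>\<^sup>+y. ennreal (b x) * indicator B y \<partial>lebesgue)"
      using B' b0[of x] v by (simp add: nn_integral_cmult_indicator v_def ennreal_mult)
    also have "\<dots> \<le> (\<integral>\<^sup>+y. ennreal \<bar>b y\<bar> * indicator B y + ennreal z * indicator B y \<partial>lebesgue)"
    proof (rule nn_integral_mono_AE, use ae in eventually_elim)
      case (elim y)
      then show ?case using osc[of y] b0[of y] z
        by (auto simp: ennreal_plus[symmetric] simp del: ennreal_plus split: split_indicator intro!: ennreal_leI)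
    qed
    also have "\<dots> = ?I + ennreal (z * v)"
      using B' z v by (simp add: nn_integral_add nn_integral_cmult_indicator v_def ennreal_mult)
    finally have le: "ennreal (b x * v) \<le> ?I + ennreal (z * v)" .
    have tv: "t * v powr (- 1 + \<alpha> / DIM('a)) = 1 / v"
    proof -
      have "t * v powr (- 1 + \<alpha> / DIM('a)) = v powr (- \<alpha> / DIM('a) + (- 1 + \<alpha> / DIM('a)))"
        unfolding t_def by (rule powr_add[symmetric])
      also have "- \<alpha> / DIM('a) + (- 1 + \<alpha> / DIM('a)) = - 1" by simp
      finally show ?thesis using v by (simp add: powr_minus inverse_eq_divide)
    qed
    have "ennreal (b x) = ennreal (1 / v) * ennreal (b x * v)"
      using v b0[of x] by (simp add: ennreal_mult[symmetric])
    also have "\<dots> \<le> ennreal (1 / v) * (?I + ennreal (z * v))"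
      by (intro mult_left_mono le) simp
    also have "\<dots> = ennreal (1 / v) * ?I + ennreal z"
      using v z by (simp add: distrib_left ennreal_mult[symmetric])
    also have "ennreal (1 / v) * ?I = ennreal t * (ennreal (v powr (- 1 + \<alpha> / DIM('a))) * ?I)"
      using t unfolding tv[symmetric] by (simp add: ennreal_mult mult.assoc)
    also have "\<dots> \<le> ennreal t * ?M"
      unfolding v_def by (intro mult_left_mono frac_max_local_upper B) auto
    finally show ?thesis by (simp add: add_right_mono)
  qed
  have "ennreal t * ?M \<noteq> top" using upper by (auto simp: top_unique)
  then obtain p where p: "?M = ennreal p" "0 \<le> p"
    using t by (cases ?M) (auto simp: ennreal_mult_top)
  have "t * p \<le> b x + z"
    using upper p t z b0[of x] by (simp add: ennreal_mult[symmetric] ennreal_le_iff del: ennreal_plus)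
  moreover have "b x \<le> t * p + z"
    using lower p t z b0[of x]
    by (simp add: ennreal_mult[symmetric] ennreal_plus[symmetric] ennreal_le_iff del: ennreal_plus)
  ultimately show ?thesis unfolding v_def[symmetric] t_def[symmetric] using p by simp
qed

theorem lipschitz_imp_local_bound:
  fixes b :: "'a::euclidean_space \<Rightarrow> real"
  assumes "0 < \<beta>" "0 \<le> \<alpha>" "locally_integrable b" and b0: "\<And>x. 0 \<le> b x"
    and "young \<Psi>" "b \<in> lipschitz_space \<beta>"
  obtains C where "0 < C"
    "\<And>B. B \<in> balls \<Longrightarrow> ennreal (vol B powr (- \<beta> / DIM('a)) * young_inv \<Psi> (1 / vol B)) *
       orlicz_norm_on \<Psi> B (\<lambda>x. ereal (b x) -
         ereal (vol B powr (- \<alpha> / DIM('a))) * enn2ereal (frac_max_local \<alpha> B b x)) \<le> ennreal C"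
proof -
  note [measurable] = locally_integrable_measurable[OF assms(3)]
  obtain b' L where b': "AE x in lebesgue. b x = b' x" "0 < L" "\<And>x y. \<bar>b' x - b' y\<bar> \<le> L * norm (x - y) powr \<beta>"
    using lipschitz_spaceE[OF assms(6)] by metis
  define K where "K = L * ball_const TYPE('a) \<beta>"
  have K: "0 < K" using b' ball_const_pos[where 'a = 'a, of \<beta>] by (simp add: K_def)
  show ?thesis
  proof (rule that[OF K])
    fix B :: "'a set" assume B: "B \<in> balls"
    note B' = balls_imp_vol_pos[OF B]
    define v where "v = vol B"
    define u where "u = young_inv \<Psi> (1 / v)"
    define z where "z = K * v powr (\<beta> / DIM('a))"
    have v: "0 < v" using B' by (simp add: v_def)
    have u: "0 < u" unfolding u_def using v by (intro young_inv_pos assms) simp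
    have z: "0 < z" using K v by (simp add: z_def)
    let ?g = "\<lambda>x. ereal (b x) - ereal (v powr (- \<alpha> / DIM('a))) * enn2ereal (frac_max_local \<alpha> B b x)"
    \<comment> \<open>The expression is at most \<open>z\<close> almost everywhere on
      \<open>B\<close>. After division by \<open>z / u\<close> it is at most \<open>u\<close>, where
      \<Psi> is at most \<open>1 / v\<close>, so the modular is at most 1.\<close>
    have "orlicz_norm_on \<Psi> B ?g \<le> ennreal (z / u)"
      unfolding orlicz_norm_on_def
    proof (rule orlicz_norm_le)
      show "0 < z / u" using z u by simp
      have "(\<integral>\<^sup>+x. young_ext \<Psi> (\<bar>?g x * indicator B x\<bar> / ereal (z / u)) \<partial>lebesgue) \<le>
          (\<integral>\<^sup>+x. ennreal (1 / v) * indicator B x \<partial>lebesgue)"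
      proof (rule nn_integral_mono_AE, use b'(1) in eventually_elim)
        case (elim x)
        show ?case
        proof (cases "x \<in> B")
          case True
          have "\<bar>?g x\<bar> \<le> ereal z"
            unfolding z_def K_def v_def
            by (rule frac_max_local_bounds[OF assms(1,2) less_imp_le[OF b'(2)] b'(3,1) b0 _ B True elim]) measurable
          then have "\<bar>?g x\<bar> / ereal (z / u) \<le> ereal z / ereal (z / u)"
            using z u by (intro ereal_divide_right_mono) auto
          also have "\<dots> = ereal u" using z u by simp
          finally have "young_ext \<Psi> (\<bar>?g x\<bar> / ereal (z / u)) \<le> young_ext \<Psi> (ereal u)"
            using z u by (intro young_ext_mono assms) auto
          also have "\<dots> \<le> ennreal (1 / v)"
            using young_young_inv_le[OF assms(5), of "1 / v"] v by (simp add: young_ext_def u_def)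
          finally show ?thesis using True by simp
        next
          case False
          then show ?thesis using assms(5) by (simp add: young_ext_def young_def)
        qed
      qed
      also have "\<dots> = 1"
        using B' v by (simp add: nn_integral_cmult_indicator v_def ennreal_mult[symmetric])
      finally show "(\<integral>\<^sup>+x. young_ext \<Psi> (\<bar>?g x * indicator B x\<bar> / ereal (z / u)) \<partial>lebesgue) \<le> 1" .
    qed
    then have "ennreal (v powr (- \<beta> / DIM('a)) * u) * orlicz_norm_on \<Psi> B ?g \<le>
        ennreal (v powr (- \<beta> / DIM('a)) * u) * ennreal (z / u)"
      by (intro mult_left_mono) auto
    also have "\<dots> = ennreal (v powr (- \<beta> / DIM('a)) * u * (z / u))"
      using z u by (subst ennreal_mult) auto
    also have "v powr (- \<beta> / DIM('a)) * u * (z / u) = K * (v powr (- \<beta> / DIM('a)) * v powr (\<beta> / DIM('a)))"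
      using u by (simp add: z_def)
    also have "v powr (- \<beta> / DIM('a)) * v powr (\<beta> / DIM('a)) = 1"
      using v by (simp add: powr_add[symmetric])
    finally show "ennreal (vol B powr (- \<beta> / DIM('a)) * young_inv \<Psi> (1 / vol B)) *
       orlicz_norm_on \<Psi> B (\<lambda>x. ereal (b x) -
         ereal (vol B powr (- \<alpha> / DIM('a))) * enn2ereal (frac_max_local \<alpha> B b x)) \<le> ennreal K"
      by (simp add: u_def v_def)
  qed
qed

theorem local_bound_imp_lipschitz:
  fixes b :: "'a::euclidean_space \<Rightarrow> real"
  assumes "0 < \<beta>" and li: "locally_integrable b" and b0: "\<And>x. 0 \<le> b x" and "young \<Psi>" "0 < C"
    and C: "\<And>B. B \<in> balls \<Longrightarrow> ennreal (vol B powr (- \<beta> / DIM('a)) * young_inv \<Psi> (1 / vol B)) *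
       orlicz_norm_on \<Psi> B (\<lambda>x. ereal (b x) -
         ereal (vol B powr (- \<alpha> / DIM('a))) * enn2ereal (frac_max_local \<alpha> B b x)) \<le> ennreal C"
  shows "b \<in> lipschitz_space \<beta>"
proof (rule oscillation_imp_lipschitz[OF li assms(1), of "8 * C"])
  fix c :: 'a and r :: real assume r: "0 < r"
  define B where "B = ball c r"
  define v where "v = vol B"
  define m where "m = ball_avg b B"
  define u where "u = young_inv \<Psi> (1 / v)"
  have B: "B \<in> balls" using r by (auto simp: B_def balls_def)
  have v: "0 < v" using balls_imp_vol_pos[OF B] by (simp add: v_def)
  have m: "0 \<le> m" using b0 by (simp add: m_def ball_avg_nonneg)
  have u: "0 < u" unfolding u_def using v by (intro young_inv_pos assms) simp
  define t where "t = v powr (- \<alpha> / DIM('a))"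
  have t: "0 < t" using v by (simp add: t_def)
  let ?g = "\<lambda>x. (ereal (b x) - ereal t * enn2ereal (frac_max_local \<alpha> B b x)) * indicator B x"
  define k where "k = v powr (- \<beta> / DIM('a)) * u"
  have k: "0 < k" using v u by (simp add: k_def)
  have "ennreal k * orlicz_norm \<Psi> ?g \<le> ennreal C"
    using C[OF B] by (simp add: orlicz_norm_on_def k_def u_def t_def v_def)
  then have "ennreal (1 / k) * (ennreal k * orlicz_norm \<Psi> ?g) \<le> ennreal (1 / k) * ennreal C"
    by (intro mult_left_mono) auto
  moreover have "ennreal (1 / k) * (ennreal k * w) = w" for w
    using k by (simp add: mult.assoc[symmetric] ennreal_mult[symmetric])
  ultimately have "orlicz_norm \<Psi> ?g \<le> ennreal (1 / k) * ennreal C" by simp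
  \<comment> \<open>Strictness again supplies an admissible \<open>l\<close> below the bound; 2
    times the 4 of \<open>mean_oscillation_le\<close> is the 8 in the claim.\<close>
  also have "\<dots> < ennreal (2 * C / k)"
    using k assms(5) by (simp add: ennreal_mult[symmetric] ennreal_less_iff divide_strict_right_mono)
  finally obtain l where l: "0 < l" "l < 2 * C / k"
      "(\<integral>\<^sup>+x. young_ext \<Psi> (\<bar>?g x\<bar> / ereal l) \<partial>lebesgue) \<le> 1"
    by (rule orlicz_norm_admissible)
  \<comment> \<open>The factor is 1 here because the local expression already carries the
    normalisation \<open>vol B powr (- \<alpha> / DIM('a))\<close>.\<close>
  have "ereal (1 * (m - b x)) \<le> \<bar>?g x\<bar>" if x: "x \<in> B" "b x \<le> m" for x
  proof -
    have e: "t * v powr (- 1 + \<alpha> / DIM('a)) = 1 / v"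
    proof -
      have "t * v powr (- 1 + \<alpha> / DIM('a)) = v powr (- \<alpha> / DIM('a) + (- 1 + \<alpha> / DIM('a)))"
        unfolding t_def by (rule powr_add[symmetric])
      also have "- \<alpha> / DIM('a) + (- 1 + \<alpha> / DIM('a)) = - 1" by simp
      finally show ?thesis using v by (simp add: powr_minus inverse_eq_divide)
    qed
    have "ennreal m = ennreal (1 / v) * ennreal (v * m)"
      using v m by (simp add: ennreal_mult[symmetric])
    also have "\<dots> = ennreal t * (ennreal (v powr (- 1 + \<alpha> / DIM('a))) * ennreal (v * m))"
      using t unfolding e[symmetric] by (simp add: ennreal_mult mult.assoc)
    also have "ennreal (v * m) = (\<integral>\<^sup>+y\<in>B. ennreal \<bar>b y\<bar> \<partial>lebesgue)"
      using nn_integral_abs_eq_avg[OF li b0 r, of c] by (simp add: v_def m_def B_def)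
    also have "ennreal t * (ennreal (v powr (- 1 + \<alpha> / DIM('a))) * \<dots>) \<le> ennreal t * frac_max_local \<alpha> B b x"
      unfolding v_def by (intro mult_left_mono frac_max_local_upper B x) auto
    finally have le: "ennreal m \<le> ennreal t * frac_max_local \<alpha> B b x" .
    show ?thesis
    proof (cases "frac_max_local \<alpha> B b x")
      case (real q)
      then have "m \<le> t * q" using le t by (simp add: ennreal_mult[symmetric] ennreal_le_iff)
      then show ?thesis using real x by simp
    next
      case top
      then show ?thesis using x t by simp
    qed
  qed
  then have "(LINT x:ball c r|lebesgue. \<bar>b x - ball_avg b (ball c r)\<bar>) \<le> 4 * (l / 1) * v * u"
    unfolding v_def u_def B_def
    by (intro mean_oscillation_le[OF assms(4) li r zero_less_one _ l(1,3)[unfolded B_def]])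
      (auto simp: m_def B_def)
  also have "\<dots> \<le> 4 * (2 * C / k) * v * u"
    using l v u by (intro mult_right_mono mult_left_mono) auto
  also have "\<dots> = 8 * C * v * (u / k)" by simp
  also have "u / k = v powr (\<beta> / DIM('a))"
    using v u by (simp add: k_def powr_minus divide_inverse)
  finally show "(LINT x:ball c r|lebesgue. \<bar>b x - ball_avg b (ball c r)\<bar>) \<le>
      8 * C * vol (ball c r) * vol (ball c r) powr (\<beta> / DIM('a))"
    by (simp add: v_def B_def)
qed

theorem theorem4p13:
  fixes b :: "real ^ 'n \<Rightarrow> real" and \<alpha> \<beta> :: real and \<Phi> \<Psi> :: "real \<Rightarrow> ennreal"
  assumes "0 < \<beta>" and "\<beta> < 1" and "0 \<le> \<alpha>" and "\<alpha> < CARD('n)"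
    and "0 < \<alpha> + \<beta>" and "\<alpha> + \<beta> < CARD('n)"
    and "locally_integrable b" and "\<forall>x. 0 \<le> b x"
    and "young \<Phi>" and "young \<Psi>" and "\<Phi> \<in> young_Y \<inter> nabla2"
    and "\<exists>C\<^sub>1>0. \<exists>C\<^sub>2>0. \<forall>t>0.
           C\<^sub>1 * young_inv \<Phi> t * t powr (- (\<alpha> + \<beta>) / CARD('n)) \<le> young_inv \<Psi> t \<and>
           young_inv \<Psi> t \<le> C\<^sub>2 * young_inv \<Phi> t * t powr (- (\<alpha> + \<beta>) / CARD('n))"
  shows "(b \<in> lipschitz_space \<beta> \<longleftrightarrow> orlicz_bounded \<Phi> \<Psi> (commutator b \<alpha>)) \<and>
         (orlicz_bounded \<Phi> \<Psi> (commutator b \<alpha>) \<longleftrightarrow>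
           (\<exists>C>0. (SUP B\<in>balls.
              ennreal (vol B powr (- \<beta> / CARD('n)) * young_inv \<Psi> (1 / vol B)) *
              orlicz_norm_on \<Psi> B
                (\<lambda>x. ereal (b x) -
                      ereal (vol B powr (- \<alpha> / CARD('n))) * enn2ereal (frac_max_local \<alpha> B b x)))
            \<le> ennreal C))"
    (is "(?lip \<longleftrightarrow> ?bd) \<and> (?bd \<longleftrightarrow> ?loc)")
proof -
  have dim: "CARD('n) = DIM(real ^ 'n)" by simp
  obtain C\<^sub>1 C\<^sub>2 where C: "0 < C\<^sub>1" "0 < C\<^sub>2"
    and C1: "\<And>t. 0 < t \<Longrightarrow> C\<^sub>1 * young_inv \<Phi> t * t powr (- (\<alpha> + \<beta>) / DIM(real ^ 'n)) \<le> young_inv \<Psi> t"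
    and C2: "\<And>t. 0 < t \<Longrightarrow> young_inv \<Psi> t \<le> C\<^sub>2 * young_inv \<Phi> t * t powr (- (\<alpha> + \<beta>) / DIM(real ^ 'n))"
    using assms(12) unfolding dim by blast
  have b0: "\<And>x. 0 \<le> b x" using assms(8) by blast
  have \<Phi>: "\<Phi> \<in> young_Y" using assms(11) by blast
  \<comment> \<open>All four implications have the Lipschitz condition at one end; the equivalence
    of the two boundedness properties passes through it.\<close>
  have "?lip \<Longrightarrow> ?bd"
    by (rule lipschitz_imp_commutator_bounded[OF assms(1,3,7) b0 assms(11,10) C(1) C1])
  moreover have "?bd \<Longrightarrow> ?lip"
    by (rule commutator_bounded_imp_lipschitz[OF assms(1,3) assms(4)[unfolded dim] assms(7) b0 \<Phi> assms(10) C(2) C2])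
  moreover have "?lip \<Longrightarrow> ?loc"
    unfolding SUP_le_iff dim
    by (rule lipschitz_imp_local_bound[OF assms(1,3,7) b0 assms(10)]) blast+
  moreover have "?loc \<Longrightarrow> ?lip"
    unfolding SUP_le_iff dim
    using local_bound_imp_lipschitz[OF assms(1,7) b0 assms(10)] by blast
  ultimately show ?thesis by blast
qed

end
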